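(* Let $a,b,c\in\mathbb{R}$ with $a^2+b^2+c^2\neq0$ and let $\mathfrak{g}_{a,b,c}$ be the $7$-dimensional real Lie algebra with basis $\{e_1,\ldots,e_7\}$ and nonzero brackets $$[e_1,e_2]=ae_3,\ [e_1,e_3]=-ae_2,\ [e_1,e_4]=be_5,\ [e_1,e_5]=-be_4,\ [e_1,e_6]=ce_7,\ [e_1,e_7]=-ce_6.$$ Let $\varphi=e^{123}+e^{145}+e^{167}+e^{246}-e^{257}-e^{347}-e^{356}\in\bigwedge^3\mathfrak{g}_{a,b,c}^*$. Then $\varphi$ is coclosed for any choice of $a,b,c$, and $\varphi$ is closed (therefore torsion-free) if and only if $a+b+c=0$.
   Context: $\{e^i\}$ is the dual basis and $e^{ijk}=e^i\wedge e^j\wedge e^k$. $d$ is the Chevalley–Eilenberg differential, $d\alpha(x,y)=-\alpha([x,y])$ on $1$-forms. The $3$-form $\varphi$ is a $G_2$-structure on the Lie algebra: it induces the inner product $g_\varphi$ for which $\{e_i\}$ is orthonormal and the volume form $e^{1\cdots7}$; $\star_\varphi$ is the corresponding Hodge star. $\varphi$ is closed if $d\varphi=0$, coclosed if $d\star_\varphi\varphi=0$, and torsion-free if both hold. *)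

theory Defs
  imports "HOL-Analysis.Analysis"
begin

subsection \<open>Alternating forms\<close>

text \<open>A \<open>k\<close>-form is a function on argument lists that is multilinear and alternating on lists of
  length \<open>k\<close> and, so that equality of forms is equality of functions, zero on all other lists.\<close>

type_synonym 'v form = "'v list \<Rightarrow> real"

definition alternating_form :: "nat \<Rightarrow> 'v::real_vector form \<Rightarrow> bool" where
  "alternating_form k \<alpha> \<longleftrightarrow>
     (\<forall>xs. length xs \<noteq> k \<longrightarrow> \<alpha> xs = 0) \<and>
     (\<forall>xs. \<forall>i<k. length xs = k \<longrightarrow> linear (\<lambda>v. \<alpha> (xs[i := v]))) \<and>
     (\<forall>xs. length xs = k \<and> \<not> distinct xs \<longrightarrow> \<alpha> xs = 0)"

text \<open>The sum over shuffles: \<open>S\<close> is the set of argument positions given to \<open>\<alpha>\<close>, and the sign is that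
  of the permutation moving these positions to the front. If \<open>\<alpha>\<close> is a \<open>p\<close>-form, only the \<open>S\<close> with
  \<open>p\<close> elements contribute. The normalisation is the one with \<open>(e\<^sup>1 \<and> e\<^sup>2)(e\<^sub>1, e\<^sub>2) = 1\<close>.\<close>

definition wedge :: "'v form \<Rightarrow> 'v form \<Rightarrow> 'v form" (infixr \<open>\<and>\<^sub>f\<close> 70) where
  "(\<alpha> \<and>\<^sub>f \<beta>) xs = (\<Sum>S\<in>Pow {..<length xs}.
      (- 1) ^ card {(i, j). i \<in> S \<and> j \<in> {..<length xs} - S \<and> j < i}
      * \<alpha> (nths xs S) * \<beta> (nths xs (- S)))"

definition interior :: "'v \<Rightarrow> 'v form \<Rightarrow> 'v form" where
  "interior v \<alpha> xs = \<alpha> (v # xs)"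

subsection \<open>Lie brackets and the Chevalley--Eilenberg differential\<close>

definition lie_bracket :: "('v::real_vector \<Rightarrow> 'v \<Rightarrow> 'v) \<Rightarrow> bool" where
  "lie_bracket br \<longleftrightarrow> bilinear br \<and> (\<forall>x. br x x = 0) \<and>
     (\<forall>x y z. br x (br y z) + br y (br z x) + br z (br x y) = 0)"

text \<open>\<open>d\<alpha>(x\<^sub>0, \<dots>, x\<^sub>k) = \<Sum>\<^sub>i\<^sub><\<^sub>j (-1)\<^sup>i\<^sup>+\<^sup>j \<alpha>([x\<^sub>i, x\<^sub>j], x\<^sub>0, \<dots>, x\<^sub>k)\<close> with \<open>x\<^sub>i\<close> and \<open>x\<^sub>j\<close> omitted from the
  tail; on 1-forms this is \<open>d\<alpha>(x, y) = -\<alpha>([x, y])\<close>.\<close>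

definition ce_diff :: "('v \<Rightarrow> 'v \<Rightarrow> 'v) \<Rightarrow> 'v form \<Rightarrow> 'v form" where
  "ce_diff br \<alpha> xs = (\<Sum>j<length xs. \<Sum>i<j.
      (- 1) ^ (i + j) * \<alpha> (br (xs ! i) (xs ! j) # nths xs (- {i, j})))"

subsection \<open>Inner products, volume forms and the Hodge star\<close>

text \<open>The class \<open>euclidean_space\<close> is used only as a supply of finite-dimensional vector spaces: the
  inner product \<open>g\<close> is an arbitrary one, not the one of the class.\<close>

definition inner_product :: "('v::real_vector \<Rightarrow> 'v \<Rightarrow> real) \<Rightarrow> bool" where
  "inner_product g \<longleftrightarrow> bilinear g \<and> (\<forall>x y. g x y = g y x) \<and> (\<forall>x. x \<noteq> 0 \<longrightarrow> 0 < g x x)"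

definition orthonormal_basis :: "('v::real_vector \<Rightarrow> 'v \<Rightarrow> real) \<Rightarrow> 'v set \<Rightarrow> bool" where
  "orthonormal_basis g B \<longleftrightarrow>
     span B = UNIV \<and> (\<forall>x\<in>B. \<forall>y\<in>B. g x y = (if x = y then 1 else 0))"

text \<open>The two volume forms of \<open>g\<close> correspond to the two orientations.\<close>

definition volume_form :: "('v::euclidean_space \<Rightarrow> 'v \<Rightarrow> real) \<Rightarrow> 'v form \<Rightarrow> bool" where
  "volume_form g vol \<longleftrightarrow> alternating_form DIM('v) vol \<and>
     (\<forall>xs. distinct xs \<and> orthonormal_basis g (set xs) \<longrightarrow> \<bar>vol xs\<bar> = 1)"

text \<open>The inner product on \<open>k\<close>-forms for which the \<open>f\<^sup>I\<close>, \<open>I\<close> increasing, are orthonormal when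
  \<open>f\<close> is an orthonormal basis. Summing over all \<open>k\<close>-tuples of basis vectors counts each \<open>I\<close>
  \<open>k!\<close> times; the value does not depend on the basis chosen.\<close>

definition form_inner ::
  "('v::euclidean_space \<Rightarrow> 'v \<Rightarrow> real) \<Rightarrow> nat \<Rightarrow> 'v form \<Rightarrow> 'v form \<Rightarrow> real" where
  "form_inner g k \<alpha> \<beta> = (let B = (SOME B. orthonormal_basis g B) in
     (\<Sum>xs | set xs \<subseteq> B \<and> length xs = k. \<alpha> xs * \<beta> xs) / fact k)"

text \<open>For a \<open>k\<close>-form \<open>\<beta>\<close>, the form \<open>\<star>\<beta>\<close> is determined by \<open>\<alpha> \<and> \<star>\<beta> = g(\<alpha>, \<beta>) vol\<close>.\<close>

definition hodge_star ::
  "('v::euclidean_space \<Rightarrow> 'v \<Rightarrow> real) \<Rightarrow> 'v form \<Rightarrow> nat \<Rightarrow> 'v form \<Rightarrow> 'v form" where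
  "hodge_star g vol k \<beta> = (THE \<gamma>. alternating_form (DIM('v) - k) \<gamma> \<and>
     (\<forall>\<alpha>. alternating_form k \<alpha> \<longrightarrow> \<alpha> \<and>\<^sub>f \<gamma> = (\<lambda>xs. form_inner g k \<alpha> \<beta> * vol xs)))"

subsection \<open>\<open>G\<^sub>2\<close>-structures\<close>

text \<open>A 3-form \<open>\<phi>\<close> induces \<open>g\<^sub>\<phi>\<close> and \<open>vol\<^sub>\<phi>\<close> through
  \<open>\<iota>\<^sub>x\<phi> \<and> \<iota>\<^sub>y\<phi> \<and> \<phi> = 6 g\<^sub>\<phi>(x, y) vol\<^sub>\<phi>\<close>, where \<open>vol\<^sub>\<phi>\<close> is a volume form of \<open>g\<^sub>\<phi>\<close>; at most one pair
  \<open>(g\<^sub>\<phi>, vol\<^sub>\<phi>)\<close> satisfies this, and \<open>\<phi>\<close> is a \<open>G\<^sub>2\<close>-structure if one does.\<close>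

definition g2_induces :: "(real^7) form \<Rightarrow> (real^7 \<Rightarrow> real^7 \<Rightarrow> real) \<Rightarrow> (real^7) form \<Rightarrow> bool" where
  "g2_induces \<phi> g vol \<longleftrightarrow> inner_product g \<and> volume_form g vol \<and>
     (\<forall>x y. interior x \<phi> \<and>\<^sub>f interior y \<phi> \<and>\<^sub>f \<phi> = (\<lambda>xs. 6 * g x y * vol xs))"

definition g2_metric :: "(real^7) form \<Rightarrow> real^7 \<Rightarrow> real^7 \<Rightarrow> real" where
  "g2_metric \<phi> = (THE g. \<exists>vol. g2_induces \<phi> g vol)"

definition g2_volume :: "(real^7) form \<Rightarrow> (real^7) form" where
  "g2_volume \<phi> = (THE vol. \<exists>g. g2_induces \<phi> g vol)"

definition g2_closed :: "(real^7 \<Rightarrow> real^7 \<Rightarrow> real^7) \<Rightarrow> (real^7) form \<Rightarrow> bool" where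
  "g2_closed br \<phi> \<longleftrightarrow> ce_diff br \<phi> = (\<lambda>_. 0)"

definition g2_coclosed :: "(real^7 \<Rightarrow> real^7 \<Rightarrow> real^7) \<Rightarrow> (real^7) form \<Rightarrow> bool" where
  "g2_coclosed br \<phi> \<longleftrightarrow>
     ce_diff br (hodge_star (g2_metric \<phi>) (g2_volume \<phi>) 3 \<phi>) = (\<lambda>_. 0)"

definition g2_torsion_free :: "(real^7 \<Rightarrow> real^7 \<Rightarrow> real^7) \<Rightarrow> (real^7) form \<Rightarrow> bool" where
  "g2_torsion_free br \<phi> \<longleftrightarrow> g2_closed br \<phi> \<and> g2_coclosed br \<phi>"

subsection \<open>The Lie algebra and the 3-form\<close>

text \<open>The basis is indexed by the seven-element type \<open>7\<close>, in which the numerals \<open>1, \<dots>, 7\<close> are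
  distinct (and \<open>7 = 0\<close>).\<close>

definition e :: "7 \<Rightarrow> real^7" where
  "e i = axis i 1"

text \<open>\<open>dual_form [i, j, k]\<close> is \<open>e\<^sup>i \<and> e\<^sup>j \<and> e\<^sup>k\<close>; the empty product is the constant 0-form 1.\<close>

primrec dual_form :: "7 list \<Rightarrow> (real^7) form" where
  "dual_form [] = (\<lambda>xs. if xs = [] then 1 else 0)"
| "dual_form (i # is) =
     (\<lambda>xs. if length xs = 1 then hd xs $ i else 0) \<and>\<^sub>f dual_form is"

text \<open>Each summand contributes one of the given brackets \<open>[e\<^sub>i, e\<^sub>j]\<close> with \<open>i < j\<close>, weighted by
  \<open>e\<^sup>i\<^sup>j(x, y) = x\<^sub>i y\<^sub>j - x\<^sub>j y\<^sub>i\<close>.\<close>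

definition g_bracket :: "real \<Rightarrow> real \<Rightarrow> real \<Rightarrow> real^7 \<Rightarrow> real^7 \<Rightarrow> real^7" where
  "g_bracket a b c x y =
      (x$1 * y$2 - x$2 * y$1) *\<^sub>R (a *\<^sub>R e 3) + (x$1 * y$3 - x$3 * y$1) *\<^sub>R (- a *\<^sub>R e 2)
    + (x$1 * y$4 - x$4 * y$1) *\<^sub>R (b *\<^sub>R e 5) + (x$1 * y$5 - x$5 * y$1) *\<^sub>R (- b *\<^sub>R e 4)
    + (x$1 * y$6 - x$6 * y$1) *\<^sub>R (c *\<^sub>R e 7) + (x$1 * y$7 - x$7 * y$1) *\<^sub>R (- c *\<^sub>R e 6)"

lemma g_bracket_basis:
  "g_bracket a b c (e 1) (e 2) = a *\<^sub>R e 3" "g_bracket a b c (e 1) (e 3) = - a *\<^sub>R e 2"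
  "g_bracket a b c (e 1) (e 4) = b *\<^sub>R e 5" "g_bracket a b c (e 1) (e 5) = - b *\<^sub>R e 4"
  "g_bracket a b c (e 1) (e 6) = c *\<^sub>R e 7" "g_bracket a b c (e 1) (e 7) = - c *\<^sub>R e 6"
  "i \<noteq> 1 \<Longrightarrow> j \<noteq> 1 \<Longrightarrow> g_bracket a b c (e i) (e j) = 0"
  by (auto simp: g_bracket_def e_def axis_def)

lemma lie_bracket_g_bracket: "lie_bracket (g_bracket a b c)"
  unfolding lie_bracket_def
proof (intro conjI allI)
  show "bilinear (g_bracket a b c)"
    by (auto simp: bilinear_def linear_iff g_bracket_def algebra_simps scaleR_add_left)
  show "g_bracket a b c x x = 0" for x
    by (simp add: g_bracket_def)
  show "g_bracket a b c x (g_bracket a b c y z) + g_bracket a b c y (g_bracket a b c z x)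
      + g_bracket a b c z (g_bracket a b c x y) = 0" for x y z
    by (simp add: g_bracket_def e_def axis_def vec_eq_iff) (auto simp: algebra_simps)
qed

definition g2_phi :: "(real^7) form" where
  "g2_phi xs = dual_form [1,2,3] xs + dual_form [1,4,5] xs + dual_form [1,6,7] xs
     + dual_form [2,4,6] xs - dual_form [2,5,7] xs - dual_form [3,4,7] xs - dual_form [3,5,6] xs"

end

theory Submission
  imports Defs "HOL-Library.Sublist"
begin

text \<open>Interior products reduce every claim about a \<open>k\<close>-form to one about \<open>(k - 1)\<close>-forms: \<open>\<iota>\<^sub>x\<close> is an
  antiderivation of the wedge product and, by Cartan's formula, anticommutes with \<open>d\<close> up to a Lie
  derivative. So wedge products and differentials of alternating forms are alternating, and
  identities between them need only be checked on increasing lists of basis vectors. On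
  \<open>(e\<^sub>1, \<dots>, e\<^sub>7)\<close>, \<open>\<iota>\<^sub>x\<phi> \<and> \<iota>\<^sub>y\<phi> \<and> \<phi>\<close> takes the value \<open>6 (x \<bullet> y)\<close>, which identifies metric and volume; then
  \<open>\<star>\<phi>\<close> is the explicit 4-form \<open>g2_psi\<close>, whose differential vanishes on basis vectors, while every
  coefficient of \<open>d\<phi>\<close> is \<open>0\<close> or \<open>\<plusminus>(a + b + c)\<close>.\<close>

subsection \<open>Alternating forms and the wedge product\<close>

lemma alternating_formD:
  assumes "alternating_form k \<alpha>"
  shows "length xs \<noteq> k \<Longrightarrow> \<alpha> xs = 0"
    and "i < k \<Longrightarrow> length xs = k \<Longrightarrow> linear (\<lambda>v. \<alpha> (xs[i := v]))"
    and "\<not> distinct xs \<Longrightarrow> \<alpha> xs = 0"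
  using assms unfolding alternating_form_def by blast+

lemma linear_zero_fun: "linear (\<lambda>x. 0 :: real)"
  by (simp add: linear_iff)

lemma alternating_form_linear_Cons:
  assumes "alternating_form k \<alpha>"
  shows "linear (\<lambda>x. \<alpha> (x # xs))"
proof (cases "k = Suc (length xs)")
  case True
  then show ?thesis
    using alternating_formD(2)[OF assms, of 0 "0 # xs"] by simp
next
  case False
  then show ?thesis
    using alternating_formD(1)[OF assms] by (simp add: linear_zero_fun)
qed

text \<open>Polarisation: expand the zero value of \<alpha> on \<open>(x + y) # (x + y) # xs\<close>
  by additivity in the first two slots. On lists of the wrong length both sides vanish.\<close>

lemma alternating_form_swap:
  assumes "alternating_form k \<alpha>"
  shows "\<alpha> (x # y # xs) = - \<alpha> (y # x # xs)"
proof (cases "k = Suc (Suc (length xs))")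
  case True
  have l1: "linear (\<lambda>u. \<alpha> (u # v # xs))" for v
    using alternating_form_linear_Cons[OF assms] .
  have l2: "linear (\<lambda>v. \<alpha> (u # v # xs))" for u
    using alternating_formD(2)[OF assms, of "Suc 0" "u # 0 # xs"] True by simp
  have "\<alpha> ((x + y) # (x + y) # xs) = 0" "\<alpha> (x # x # xs) = 0" "\<alpha> (y # y # xs) = 0"
    by (auto intro!: alternating_formD(3)[OF assms])
  then show ?thesis
    by (simp add: linear_add[OF l1] linear_add[OF l2])
next
  case False
  then show ?thesis
    using alternating_formD(1)[OF assms] by simp
qed

lemma alternating_form_0: "alternating_form 0 \<alpha> \<longleftrightarrow> (\<forall>x xs. \<alpha> (x # xs) = 0)"
  unfolding alternating_form_def by (metis distinct.simps(1) length_0_conv less_nat_zero_code neq_Nil_conv)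

text \<open>The recursion on the degree behind many later inductions. Only two equal leading
  arguments need checking: a repetition inside the tail is seen by an interior product, and a
  repetition of the head is first moved into the tail by a swap.\<close>

lemma alternating_form_Suc:
  "alternating_form (Suc k) \<alpha> \<longleftrightarrow> \<alpha> [] = 0 \<and> (\<forall>x. alternating_form k (interior x \<alpha>)) \<and>
     (\<forall>xs. linear (\<lambda>x. \<alpha> (x # xs))) \<and> (\<forall>x xs. \<alpha> (x # x # xs) = 0)"
proof
  assume A: "alternating_form (Suc k) \<alpha>"
  have "alternating_form k (interior x \<alpha>)" for x
    unfolding alternating_form_def interior_def
    using alternating_formD(1,3)[OF A] alternating_formD(2)[OF A, of "Suc _" "x # _"] by simp
  then show "\<alpha> [] = 0 \<and> (\<forall>x. alternating_form k (interior x \<alpha>)) \<and>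
     (\<forall>xs. linear (\<lambda>x. \<alpha> (x # xs))) \<and> (\<forall>x xs. \<alpha> (x # x # xs) = 0)"
    using alternating_formD(1,3)[OF A] alternating_form_linear_Cons[OF A] by simp
next
  assume A: "\<alpha> [] = 0 \<and> (\<forall>x. alternating_form k (interior x \<alpha>)) \<and>
     (\<forall>xs. linear (\<lambda>x. \<alpha> (x # xs))) \<and> (\<forall>x xs. \<alpha> (x # x # xs) = 0)"
  then have i: "alternating_form k (interior x \<alpha>)" and l: "linear (\<lambda>x. \<alpha> (x # xs))"
    and z: "\<alpha> (x # x # xs) = 0" for x xs by blast+
  have lenz: "\<alpha> xs = 0" if "length xs \<noteq> Suc k" for xs
    using that A alternating_formD(1)[OF i] by (cases xs) (auto simp: interior_def)
  moreover have "linear (\<lambda>v. \<alpha> (xs[j := v]))" if j: "j < Suc k" and len: "length xs = Suc k" for xs j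
  proof -
    obtain y ys where xs: "xs = y # ys" "length ys = k"
      using len by (cases xs) auto
    show ?thesis
    proof (cases j)
      case 0
      then show ?thesis using xs l by simp
    next
      case (Suc j')
      then show ?thesis
        using xs j alternating_formD(2)[OF i, of j' ys y] by (simp add: interior_def)
    qed
  qed
  moreover have "\<alpha> xs = 0" if nd: "\<not> distinct xs" for xs
  proof (cases xs)
    case Nil
    then show ?thesis using nd by simp
  next
    case (Cons x xs')
    show ?thesis
    proof (cases "distinct xs'")
      case False
      then show ?thesis
        using alternating_formD(3)[OF i] Cons by (simp add: interior_def)
    next
      case True
      then have x: "x \<in> set xs'" using nd Cons by simp
      then obtain y ys where ys: "xs' = y # ys" by (cases xs') auto
      show ?thesis
      proof (cases "x = y")
        case True
        then show ?thesis using z ys Cons by simp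
      next
        case False
        then have "\<not> distinct (x # ys)" using x ys by simp
        then have "\<alpha> (y # x # ys) = 0"
          using alternating_formD(3)[OF i, of "x # ys" y] by (simp add: interior_def)
        \<comment> \<open>\<open>alternating_form_swap\<close> presupposes the claim being proved,
          so the polarisation is repeated from the linearity of \<alpha> and of its interior
          products. For \<open>k = 0\<close> both lists are too long.\<close>
        moreover have "\<alpha> (x # y # ys) = - \<alpha> (y # x # ys)"
        proof (cases k)
          case 0
          then show ?thesis using lenz by simp
        next
          case (Suc k')
          have l2: "linear (\<lambda>v. \<alpha> (u # v # ys))" for u
            using alternating_form_linear_Cons[OF i] by (simp add: interior_def)
          have "\<alpha> ((x + y) # (x + y) # ys) = 0" "\<alpha> (x # x # ys) = 0" "\<alpha> (y # y # ys) = 0"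
            using z by blast+
          then show ?thesis
            by (simp add: linear_add[OF l] linear_add[OF l2])
        qed
        ultimately show ?thesis using ys Cons by simp
      qed
    qed
  qed
  ultimately show "alternating_form (Suc k) \<alpha>"
    unfolding alternating_form_def by blast
qed

lemma alternating_form_zero [simp]: "alternating_form k (\<lambda>_. 0)"
  by (simp add: alternating_form_def linear_zero_fun)

lemma alternating_form_add:
  "alternating_form k \<alpha> \<Longrightarrow> alternating_form k \<beta> \<Longrightarrow> alternating_form k (\<lambda>xs. \<alpha> xs + \<beta> xs)"
  unfolding alternating_form_def by (auto intro: linear_compose_add)

lemma alternating_form_scale:
  "alternating_form k \<alpha> \<Longrightarrow> alternating_form k (\<lambda>xs. c * \<alpha> xs)"
  unfolding alternating_form_def by (auto simp: linear_iff algebra_simps)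

lemma alternating_form_diff:
  assumes "alternating_form k \<alpha>" "alternating_form k \<beta>"
  shows "alternating_form k (\<lambda>xs. \<alpha> xs - \<beta> xs)"
  using alternating_form_add[OF assms(1) alternating_form_scale[OF assms(2), of "-1"]] by simp

lemma alternating_form_interior:
  "alternating_form k \<alpha> \<Longrightarrow> alternating_form (k - 1) (interior x \<alpha>)"
proof (cases k)
  case 0
  assume "alternating_form k \<alpha>"
  then have "interior x \<alpha> = (\<lambda>_. 0)" using 0 by (simp add: alternating_form_0 interior_def fun_eq_iff)
  then show ?thesis by simp
qed (simp add: alternating_form_Suc)

section \<open>The wedge product and its interior products\<close>

lemma wedge_Nil: "(\<alpha> \<and>\<^sub>f \<beta>) [] = \<alpha> [] * \<beta> []"
  by (simp add: wedge_def)

lemma wedge_zero [simp]: "(\<lambda>_. 0) \<and>\<^sub>f \<beta> = (\<lambda>_. 0)" "\<alpha> \<and>\<^sub>f (\<lambda>_. 0) = (\<lambda>_. 0)"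
  by (simp_all add: wedge_def fun_eq_iff)

lemma wedge_diff_right: "(\<alpha> \<and>\<^sub>f (\<lambda>xs. \<beta> xs - \<gamma> xs)) xs = (\<alpha> \<and>\<^sub>f \<beta>) xs - (\<alpha> \<and>\<^sub>f \<gamma>) xs"
  by (simp add: wedge_def sum_subtractf algebra_simps)

text \<open>The set counted by the sign in \<open>wedge\<close>, named so that its size can be
  followed when an argument is prepended.\<close>

definition inversion_pairs :: "nat \<Rightarrow> nat set \<Rightarrow> (nat \<times> nat) set" where
  "inversion_pairs n S = {(i, j). i \<in> S \<and> j \<in> {..<n} - S \<and> j < i}"

lemma finite_inv_pairs: "S \<subseteq> {..<n} \<Longrightarrow> finite (inversion_pairs n S)"
  by (rule finite_subset[of _ "{..<n} \<times> {..<n}"]) (auto simp: inversion_pairs_def)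

text \<open>Position 0 precedes all others, so once chosen it enters no inversion; the other pairs
  are only shifted.\<close>

lemma inversion_pairs_insert_0:
  "card (inversion_pairs (Suc n) (insert 0 (Suc ` S))) = card (inversion_pairs n S)"
proof -
  have "inversion_pairs (Suc n) (insert 0 (Suc ` S)) = map_prod Suc Suc ` inversion_pairs n S"
  proof (intro set_eqI iffI)
    fix p assume "p \<in> inversion_pairs (Suc n) (insert 0 (Suc ` S))"
    then obtain i j where p: "p = (i, j)" "i \<in> insert 0 (Suc ` S)" "j < Suc n"
      "j \<notin> insert 0 (Suc ` S)" "j < i" by (auto simp: inversion_pairs_def)
    then obtain i' j' where "i = Suc i'" "j = Suc j'" "i' \<in> S" by (cases j) auto
    then show "p \<in> map_prod Suc Suc ` inversion_pairs n S"
      using p by (auto simp: inversion_pairs_def intro!: image_eqI[of _ _ "(i', j')"])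
  qed (auto simp: inversion_pairs_def)
  moreover have "inj_on (map_prod Suc Suc) (inversion_pairs n S)"
    by (auto simp: inj_on_def)
  ultimately show ?thesis by (simp add: card_image)
qed

text \<open>Position 0, now not chosen, lies before every chosen position and forms one new
  inversion with each.\<close>

lemma inversion_pairs_Suc_image:
  assumes "S \<subseteq> {..<n}"
  shows "card (inversion_pairs (Suc n) (Suc ` S)) = card (inversion_pairs n S) + card S"
proof -
  have "inversion_pairs (Suc n) (Suc ` S) = inversion_pairs (Suc n) (insert 0 (Suc ` S)) \<union> (\<lambda>i. (Suc i, 0)) ` S"
    by (auto simp: inversion_pairs_def)
  moreover have "inversion_pairs (Suc n) (insert 0 (Suc ` S)) \<inter> (\<lambda>i. (Suc i, 0)) ` S = {}"
    by (auto simp: inversion_pairs_def)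
  moreover have "finite S" using assms finite_subset by blast
  moreover have "finite (inversion_pairs (Suc n) (insert 0 (Suc ` S)))"
    using assms by (intro finite_inv_pairs) auto
  moreover have "card ((\<lambda>i. (Suc i, 0::nat)) ` S) = card S"
    by (rule card_image) (auto simp: inj_on_def)
  ultimately show ?thesis
    by (simp add: card_Un_disjoint inversion_pairs_insert_0)
qed

lemma sum_Pow_lessThan_Suc:
  fixes F :: "nat set \<Rightarrow> real"
  shows "(\<Sum>S\<in>Pow {..<Suc n}. F S) = (\<Sum>S\<in>Pow {..<n}. F (insert 0 (Suc ` S))) + (\<Sum>S\<in>Pow {..<n}. F (Suc ` S))"
proof -
  let ?A = "(\<lambda>S. insert 0 (Suc ` S)) ` Pow {..<n}" and ?B = "(\<lambda>S. Suc ` S) ` Pow {..<n}"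
  have "Pow {..<Suc n} = ?A \<union> ?B"
    by (auto simp: lessThan_Suc_eq_insert_0 Pow_insert image_Pow_surj[symmetric] image_image)
  moreover have "?A \<inter> ?B = {}" by auto
  moreover have "inj_on (\<lambda>S. insert 0 (Suc ` S)) (Pow {..<n})" "inj_on (\<lambda>S. Suc ` S) (Pow {..<n})"
    by (auto simp: inj_on_def)
  ultimately show ?thesis
    by (simp add: sum.union_disjoint sum.reindex)
qed

text \<open>Split the shuffles by whether \<open>x\<close> goes to \<alpha> or to \<beta>. In the
  second case it is passed by the \<open>card S\<close> arguments of \<alpha>, which is the source
  of the sign.\<close>

lemma wedge_Cons:
  assumes "alternating_form p \<alpha>"
  shows "(\<alpha> \<and>\<^sub>f \<beta>) (x # xs) = (interior x \<alpha> \<and>\<^sub>f \<beta>) xs + (- 1) ^ p * (\<alpha> \<and>\<^sub>f interior x \<beta>) xs"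
proof -
  let ?n = "length xs"
  have shift: "{j. Suc j \<in> insert 0 (Suc ` S)} = S" "{j. Suc j \<in> Suc ` S} = S"
    "{j. j \<notin> S} = - S" "{j. Suc j \<notin> Suc ` S} = - S" for S by auto
  have 1: "(- 1) ^ card (inversion_pairs (Suc ?n) (insert 0 (Suc ` S))) * \<alpha> (nths (x # xs) (insert 0 (Suc ` S)))
       * \<beta> (nths (x # xs) (- insert 0 (Suc ` S)))
     = (- 1) ^ card (inversion_pairs ?n S) * interior x \<alpha> (nths xs S) * \<beta> (nths xs (- S))"
    for S unfolding inversion_pairs_insert_0 by (simp add: nths_Cons shift interior_def image_iff)
  have 2: "(- 1) ^ card (inversion_pairs (Suc ?n) (Suc ` S)) * \<alpha> (nths (x # xs) (Suc ` S))
       * \<beta> (nths (x # xs) (- (Suc ` S)))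
     = (- 1) ^ p * ((- 1) ^ card (inversion_pairs ?n S) * \<alpha> (nths xs S) * interior x \<beta> (nths xs (- S)))"
    if "S \<in> Pow {..<?n}" for S
  proof -
    have "{i. i < ?n \<and> i \<in> S} = S" using that by auto
    then have "length (nths xs S) = card S" by (simp add: length_nths)
    \<comment> \<open>For \<open>card S \<noteq> p\<close> both sides are zero by the length
      condition on \<alpha>, so the sign may carry the fixed exponent \<open>p\<close>.\<close>
    then have "(- 1) ^ card S * \<alpha> (nths xs S) = (- 1) ^ p * \<alpha> (nths xs S)"
      using alternating_formD(1)[OF assms, of "nths xs S"] by (cases "card S = p") auto
    then have "(- 1) ^ card S * \<alpha> (nths xs S) * B = (- 1) ^ p * (\<alpha> (nths xs S) * B)" for B
      by auto
    moreover have "card (inversion_pairs (Suc ?n) (Suc ` S)) = card (inversion_pairs ?n S) + card S"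
      using that by (intro inversion_pairs_Suc_image) simp
    ultimately show ?thesis
      by (simp add: nths_Cons shift interior_def image_iff power_add mult.assoc mult.left_commute)
  qed
  show ?thesis
    unfolding wedge_def inversion_pairs_def[symmetric] list.size add_0_right add_Suc_right sum_Pow_lessThan_Suc
    using 1 2 by (simp add: sum_distrib_left)
qed

lemma interior_wedge:
  assumes "alternating_form p \<alpha>"
  shows "interior x (\<alpha> \<and>\<^sub>f \<beta>) =
    (\<lambda>xs. (interior x \<alpha> \<and>\<^sub>f \<beta>) xs + (- 1) ^ p * (\<alpha> \<and>\<^sub>f interior x \<beta>) xs)"
  using wedge_Cons[OF assms]
  by (simp add: interior_def[of x "\<alpha> \<and>\<^sub>f \<beta>"] fun_eq_iff)

lemma linear_wedge_Cons:
  assumes p: "alternating_form p \<alpha>" and q: "alternating_form q \<beta>"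
  shows "linear (\<lambda>x. (\<alpha> \<and>\<^sub>f \<beta>) (x # xs))"
proof -
  have "linear (\<lambda>x. (interior x \<alpha> \<and>\<^sub>f \<beta>) xs + (- 1) ^ p * (\<alpha> \<and>\<^sub>f interior x \<beta>) xs)"
    unfolding wedge_def interior_def sum_distrib_left
    using alternating_form_linear_Cons[OF p] alternating_form_linear_Cons[OF q]
    by (intro linear_compose_add linear_compose_sum ballI) (auto simp: linear_iff algebra_simps)
  then show ?thesis
    by (simp add: wedge_Cons[OF p])
qed

lemma alternating_form_0_interior:
  "alternating_form 0 \<alpha> \<Longrightarrow> interior x \<alpha> = (\<lambda>_. 0)"
  by (simp add: alternating_form_0 interior_def fun_eq_iff)

lemma interior_interior:
  assumes "alternating_form k \<alpha>"
  shows "interior x (interior x \<alpha>) = (\<lambda>_. 0)"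
  using alternating_formD(3)[OF assms] by (auto simp: interior_def fun_eq_iff)

text \<open>Induction on the total degree: \<open>interior_wedge\<close> expresses interior products
  through wedge products of total degree one less, and \<open>alternating_form_Suc\<close>
  reassembles them.\<close>

lemma alternating_form_wedge:
  assumes "alternating_form p \<alpha>" "alternating_form q \<beta>"
  shows "alternating_form (p + q) (\<alpha> \<and>\<^sub>f \<beta>)"
  using assms
proof (induction "p + q" arbitrary: p q \<alpha> \<beta>)
  case 0
  then have "alternating_form 0 \<alpha>" "alternating_form 0 \<beta>" by auto
  then have "interior x (\<alpha> \<and>\<^sub>f \<beta>) = (\<lambda>_. 0)" for x
    using interior_wedge[of 0 \<alpha>] by (simp add: alternating_form_0_interior)
  then have "alternating_form 0 (\<alpha> \<and>\<^sub>f \<beta>)"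
    unfolding alternating_form_0 interior_def by metis
  then show ?case using 0 by simp
next
  case (Suc n)
  note p = Suc.prems(1) and q = Suc.prems(2)
  have left: "alternating_form n (interior x \<alpha> \<and>\<^sub>f \<beta>)" for x
  proof (cases p)
    case 0
    then show ?thesis using p by (simp add: alternating_form_0_interior)
  next
    case (Suc p')
    then show ?thesis
      using Suc.hyps(1)[of p' q] Suc.hyps(2) alternating_form_interior[OF p] q by simp
  qed
  have right: "alternating_form n (\<alpha> \<and>\<^sub>f interior x \<beta>)" for x
  proof (cases q)
    case 0
    then show ?thesis using q by (simp add: alternating_form_0_interior)
  next
    case (Suc q')
    then show ?thesis
      using Suc.hyps(1)[of p q'] Suc.hyps(2) alternating_form_interior[OF q] p by simp
  qed
  have "(\<alpha> \<and>\<^sub>f \<beta>) [] = 0"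
    using alternating_formD(1)[OF p, of "[]"] alternating_formD(1)[OF q, of "[]"] Suc.hyps(2)
    by (cases p) (auto simp: wedge_Nil)
  moreover have "alternating_form n (interior x (\<alpha> \<and>\<^sub>f \<beta>))" for x
    unfolding interior_wedge[OF p]
    by (intro alternating_form_add alternating_form_scale left right)
  \<comment> \<open>Contracting twice with \<open>x\<close> produces the product of
    \<open>interior x \<alpha>\<close> and \<open>interior x \<beta>\<close> twice, with signs of
    exponents \<open>p - 1\<close> and \<open>p\<close>. For \<open>p = 0\<close> no such term
    arises.\<close>
  moreover have "(\<alpha> \<and>\<^sub>f \<beta>) (x # x # xs) = 0" for x xs
  proof (cases p)
    case 0
    then have "(\<alpha> \<and>\<^sub>f \<gamma>) (x # ys) = (\<alpha> \<and>\<^sub>f interior x \<gamma>) ys" for \<gamma> ys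
      using p wedge_Cons[of 0 \<alpha>] by (simp add: alternating_form_0_interior)
    then show ?thesis
      by (simp add: interior_interior[OF q])
  next
    case (Suc p')
    have "alternating_form p' (interior x \<alpha>)"
      using alternating_form_interior[OF p] Suc by simp
    then show ?thesis
      using Suc
      by (simp add: wedge_Cons[OF p] wedge_Cons[of p']
          interior_interior[OF p] interior_interior[OF q])
  qed
  ultimately show ?case
    using linear_wedge_Cons[OF p q] unfolding Suc.hyps(2)[symmetric] alternating_form_Suc by simp
qed

subsection \<open>The Chevalley--Eilenberg differential\<close>

text \<open>On alternating forms this is minus the Lie derivative along \<open>x\<close>: the sign
  \<open>(- 1) ^ j\<close> accounts for moving the bracket from place \<open>j\<close> to the
  front.\<close>

definition contract_bracket :: "('v \<Rightarrow> 'v \<Rightarrow> 'v) \<Rightarrow> 'v \<Rightarrow> 'v form \<Rightarrow> 'v form" where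
  "contract_bracket br x \<alpha> xs =
     (\<Sum>j<length xs. (- 1) ^ j * \<alpha> (br x (xs ! j) # nths xs (- {j})))"

lemma contract_bracket_Cons:
  "contract_bracket br x \<alpha> (y # ys) = \<alpha> (br x y # ys) +
     (\<Sum>j<length ys. (- 1) ^ Suc j * \<alpha> (br x (ys ! j) # y # nths ys (- {j})))"
proof -
  have "{j. j \<noteq> i} = - {i}" for i :: nat by auto
  then show ?thesis
    by (simp add: contract_bracket_def sum.lessThan_Suc_shift nths_Cons nths_all del: sum.lessThan_Suc)
qed

text \<open>The commutator of a Lie derivative with an interior product. Moving \<open>y\<close> to
  the front costs a sign, which absorbs the shift of \<open>j\<close> by one.\<close>

lemma contract_bracket_Cons_interior:
  assumes "alternating_form k \<alpha>"
  shows "contract_bracket br x \<alpha> (y # ys) =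
    \<alpha> (br x y # ys) + contract_bracket br x (interior y \<alpha>) ys"
proof -
  have "\<alpha> (br x (ys ! j) # y # zs) = - \<alpha> (y # br x (ys ! j) # zs)" for j zs
    by (rule alternating_form_swap[OF assms])
  then show ?thesis
    by (simp add: contract_bracket_Cons) (simp add: contract_bracket_def interior_def)
qed

lemma ce_diff_Cons:
  "ce_diff br \<alpha> (x # xs) = - contract_bracket br x \<alpha> xs +
     (\<Sum>j<length xs. \<Sum>i<j. (- 1) ^ (i + j) * \<alpha> (br (xs ! i) (xs ! j) # x # nths xs (- {i, j})))"
proof -
  have "{j. j \<noteq> i} = - {i}" "{j. j \<noteq> i \<and> j \<noteq> l} = - {i, l}" for i l :: nat by auto
  then show ?thesis
    by (simp add: ce_diff_def contract_bracket_def sum.lessThan_Suc_shift nths_Cons sum.distrib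
        sum_negf sum_subtractf del: sum.lessThan_Suc)
qed

text \<open>Cartan's formula, with the Lie derivative expressed through \<open>contract_bracket\<close>.\<close>

lemma ce_diff_Cons_interior:
  assumes "alternating_form k \<alpha>"
  shows "ce_diff br \<alpha> (x # xs) = - contract_bracket br x \<alpha> xs - ce_diff br (interior x \<alpha>) xs"
proof -
  have "\<alpha> (br (xs ! i) (xs ! j) # x # zs) = - \<alpha> (x # br (xs ! i) (xs ! j) # zs)" for i j zs
    by (rule alternating_form_swap[OF assms])
  then show ?thesis
    by (simp add: ce_diff_Cons) (simp add: ce_diff_def interior_def sum_negf)
qed

lemma contract_bracket_zero [simp]: "contract_bracket br x (\<lambda>_. 0) = (\<lambda>_. 0)"
  by (simp add: contract_bracket_def fun_eq_iff)

lemma ce_diff_zero [simp]: "ce_diff br (\<lambda>_. 0) = (\<lambda>_. 0)"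
  by (simp add: ce_diff_def fun_eq_iff)

lemma linear_mult_comp:
  fixes f :: "'a::real_vector \<Rightarrow> real"
  shows "linear f \<Longrightarrow> linear (\<lambda>x. c * f x)"
  by (simp add: linear_iff algebra_simps)

lemma alternating_form_contract_bracket:
  assumes br: "bilinear br"
  shows "alternating_form k \<alpha> \<Longrightarrow> alternating_form k (contract_bracket br x \<alpha>)"
proof (induction k arbitrary: \<alpha>)
  case 0
  then show ?case
    unfolding alternating_form_0 by (simp add: contract_bracket_def)
next
  case (Suc k)
  note Cons = contract_bracket_Cons_interior[OF Suc.prems, of br x]
  have "interior y (contract_bracket br x \<alpha>) =
      (\<lambda>ys. interior (br x y) \<alpha> ys + contract_bracket br x (interior y \<alpha>) ys)" for y
    using Cons by (simp add: interior_def fun_eq_iff)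
  then have "alternating_form k (interior y (contract_bracket br x \<alpha>))" for y
    using Suc by (auto simp: alternating_form_Suc intro!: alternating_form_add)
  moreover have "linear (\<lambda>y. contract_bracket br x \<alpha> (y # ys))" for ys
  proof -
    have "linear (\<lambda>y. \<alpha> (br x y # ys))"
      using linear_compose[of "br x", OF _ alternating_form_linear_Cons[OF Suc.prems]] br
      by (simp add: bilinear_def o_def)
    then show ?thesis
      unfolding Cons unfolding contract_bracket_def interior_def
      by (intro linear_compose_add linear_compose_sum ballI linear_mult_comp
          alternating_form_linear_Cons[OF Suc.prems])
  qed
  \<comment> \<open>Peeling off \<open>y\<close> twice leaves \<alpha> on
    \<open>br x y # y # ys\<close> plus \<alpha> on \<open>y # br x y # ys\<close>, which
    cancel.\<close>
  moreover have "contract_bracket br x \<alpha> (y # y # ys) = 0" for y ys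
    using Suc.prems alternating_form_swap[OF Suc.prems, of "br x y" y ys]
    by (simp add: Cons contract_bracket_Cons_interior[of k "interior y \<alpha>"] alternating_form_Suc
        interior_interior[OF Suc.prems]) (simp add: interior_def)
  moreover have "contract_bracket br x \<alpha> [] = 0"
    by (simp add: contract_bracket_def)
  ultimately show ?case
    by (simp add: alternating_form_Suc)
qed

text \<open>By Cartan's formula an interior product of the differential is a Lie derivative minus
  the differential of a form of lower degree, to which the induction hypothesis applies.\<close>

lemma alternating_form_ce_diff:
  assumes br: "bilinear br" and alt: "\<And>x. br x x = 0"
  shows "alternating_form k \<alpha> \<Longrightarrow> alternating_form (Suc k) (ce_diff br \<alpha>)"
proof (induction k arbitrary: \<alpha>)
  case (0 \<alpha>)
  have "contract_bracket br x \<alpha> xs = 0" for x xs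
    using 0 by (simp add: alternating_form_0 contract_bracket_def)
  then have "ce_diff br \<alpha> (x # xs) = 0" for x xs
    using 0 by (simp add: ce_diff_Cons alternating_form_0)
  moreover have "ce_diff br \<alpha> [] = 0" by (simp add: ce_diff_def)
  ultimately have "ce_diff br \<alpha> = (\<lambda>_. 0)"
    by (metis neq_Nil_conv)
  then show ?case by simp
next
  case (Suc k)
  note Cons = ce_diff_Cons_interior[OF Suc.prems, of br]
  have i: "alternating_form k (interior x \<alpha>)" for x
    using alternating_form_interior[OF Suc.prems] by simp
  have eq: "interior x (ce_diff br \<alpha>) =
      (\<lambda>xs. (- 1) * contract_bracket br x \<alpha> xs - ce_diff br (interior x \<alpha>) xs)" for x
    using Cons by (simp add: interior_def[of x "ce_diff _ _"] fun_eq_iff)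
  have "alternating_form (Suc k) (interior x (ce_diff br \<alpha>))" for x
    unfolding eq
    by (intro alternating_form_diff alternating_form_scale Suc.IH[OF i]
        alternating_form_contract_bracket[OF br Suc.prems])
  moreover have "linear (\<lambda>x. ce_diff br \<alpha> (x # xs))" for xs
  proof -
    have "linear (\<lambda>x. \<alpha> (br x y # ys))" for y ys
      using linear_compose[of "\<lambda>x. br x y", OF _ alternating_form_linear_Cons[OF Suc.prems]] br
      by (simp add: bilinear_def o_def)
    then show ?thesis
      unfolding Cons unfolding contract_bracket_def ce_diff_def interior_def
      by (intro linear_compose_sub linear_compose_neg linear_compose_sum ballI linear_mult_comp
          alternating_form_linear_Cons[OF Suc.prems]) auto
  qed
  \<comment> \<open>After two uses of Cartan's formula the Lie derivatives of
    \<open>interior x \<alpha>\<close> cancel; what remains contains \<open>br x x\<close> or a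
    repeated interior product.\<close>
  moreover have "ce_diff br \<alpha> (x # x # xs) = 0" for x xs
    using linear_0[OF alternating_form_linear_Cons[OF Suc.prems]]
    by (simp add: Cons ce_diff_Cons_interior[OF i] contract_bracket_Cons_interior[OF Suc.prems] alt
        interior_interior[OF Suc.prems])
  moreover have "ce_diff br \<alpha> [] = 0"
    by (simp add: ce_diff_def)
  ultimately show ?case
    by (simp add: alternating_form_Suc[of "Suc k"])
qed

subsection \<open>Evaluation on basis vectors\<close>

text \<open>Move the head of the first list to the front of the second by successive swaps, then
  compare interior products. Absolute values avoid tracking the sign of the permutation.\<close>

lemma alternating_form_abs_mset:
  assumes "alternating_form k \<alpha>" "mset xs = mset ys"
  shows "\<bar>\<alpha> xs\<bar> = \<bar>\<alpha> ys\<bar>"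
  using assms
proof (induction xs arbitrary: k \<alpha> ys)
  case Nil
  then show ?case by simp
next
  case (Cons x xs)
  have "x \<in> set ys" using Cons.prems(2) by (metis list.set_intros(1) set_mset_mset)
  then obtain as bs where ys: "ys = as @ x # bs" by (meson split_list)
  have front: "\<bar>\<beta> (as @ x # bs)\<bar> = \<bar>\<beta> (x # as @ bs)\<bar>" if "alternating_form m \<beta>" for m \<beta>
    using that
  proof (induction as arbitrary: m \<beta>)
    case Nil
    then show ?case by simp
  next
    case (Cons a as)
    have "\<bar>interior a \<beta> (as @ x # bs)\<bar> = \<bar>interior a \<beta> (x # as @ bs)\<bar>"
      using Cons.IH alternating_form_interior[OF Cons.prems] by blast
    then show ?case
      using alternating_form_swap[OF Cons.prems, of a x] by (simp add: interior_def)
  qed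
  have "\<bar>interior x \<alpha> xs\<bar> = \<bar>interior x \<alpha> (as @ bs)\<bar>"
    using Cons.IH[OF alternating_form_interior[OF Cons.prems(1)]] Cons.prems(2) ys by simp
  then show ?case
    using front[OF Cons.prems(1)] ys by (simp add: interior_def)
qed

lemma alternating_form_map_scaleR:
  assumes "alternating_form k \<alpha>" "length xs = k"
  shows "\<alpha> (map (scaleR c) xs) = c ^ k * \<alpha> xs"
  using assms
proof (induction k arbitrary: \<alpha> xs)
  case 0
  then show ?case by simp
next
  case (Suc k)
  then obtain x ys where xs: "xs = x # ys" "length ys = k" by (cases xs) auto
  have "\<alpha> (c *\<^sub>R x # zs) = c * \<alpha> (x # zs)" for zs
    using linear_cmul[OF alternating_form_linear_Cons[OF Suc.prems(1)]] by simp
  moreover have "interior x \<alpha> (map (scaleR c) ys) = c ^ k * interior x \<alpha> ys"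
    using Suc.IH alternating_form_interior[OF Suc.prems(1)] xs by simp
  ultimately show ?case using xs by (simp add: interior_def)
qed

lemma e_expansion: "(\<Sum>i\<in>UNIV. x $ i *\<^sub>R e i) = x"
  using basis_expansion[of x] by (simp add: e_def scalar_mult_eq_scaleR)

lemma linear_e_expansion:
  fixes f :: "real^7 \<Rightarrow> real"
  assumes "linear f"
  shows "f x = (\<Sum>i\<in>UNIV. x $ i * f (e i))"
proof -
  have "f x = f (\<Sum>i\<in>UNIV. x $ i *\<^sub>R e i)" by (simp add: e_expansion)
  also have "\<dots> = (\<Sum>i\<in>UNIV. x $ i * f (e i))"
    by (simp add: linear_sum[OF assms] linear_cmul[OF assms])
  finally show ?thesis .
qed

lemma alternating_form_eq_0_basis:
  fixes \<alpha> :: "(real^7) form"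
  assumes "alternating_form k \<alpha>" "\<And>is. length is = k \<Longrightarrow> \<alpha> (map e is) = 0"
  shows "\<alpha> xs = 0"
  using assms
proof (induction k arbitrary: \<alpha> xs)
  case 0
  then show ?case by (cases xs) (auto simp: alternating_form_0)
next
  case (Suc k)
  have "interior (e i) \<alpha> ys = 0" for i ys
  proof (rule Suc.IH)
    show "alternating_form k (interior (e i) \<alpha>)"
      using Suc.prems(1) by (simp add: alternating_form_Suc)
    show "interior (e i) \<alpha> (map e is) = 0" if "length is = k" for "is"
      using Suc.prems(2)[of "i # is"] that by (simp add: interior_def)
  qed
  then have "\<alpha> (x # ys) = 0" for x ys
    using linear_e_expansion[OF alternating_form_linear_Cons[OF Suc.prems(1)], of x]
    by (simp add: interior_def)
  then show ?case
    using alternating_formD(1)[OF Suc.prems(1), of "[]"] by (cases xs) auto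
qed

text \<open>\<open>L\<close> fixes an order of the indices, so that \<open>subseqs L\<close>
  enumerates the increasing index lists. Equality of forms becomes a finite check of
  coefficients.\<close>

lemma alternating_form_eqI_basis:
  fixes \<alpha> \<beta> :: "(real^7) form"
  assumes alt: "alternating_form k \<alpha>" "alternating_form k \<beta>"
    and L: "distinct L" "set L = UNIV"
    and eq: "\<And>is. is \<in> set (subseqs L) \<Longrightarrow> length is = k \<Longrightarrow> \<alpha> (map e is) = \<beta> (map e is)"
  shows "\<alpha> = \<beta>"
proof
  fix xs
  let ?\<delta> = "\<lambda>xs. \<alpha> xs - \<beta> xs"
  have \<delta>: "alternating_form k ?\<delta>" by (rule alternating_form_diff[OF alt])
  have "?\<delta> (map e js) = 0" if len: "length js = k" for js
  proof (cases "distinct js")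
    case False
    then show ?thesis
      using alternating_formD(3)[OF \<delta>, of "map e js"] by (simp add: distinct_map)
  next
    case True
    \<comment> \<open>The rearrangement of \<open>js\<close> in the order of
      \<open>L\<close>.\<close>
    let ?is = "filter (\<lambda>i. i \<in> set js) L"
    have m: "mset ?is = mset js"
      by (subst set_eq_iff_mset_eq_distinct[symmetric]) (use True L in auto)
    then have "length ?is = k" using len by (metis size_mset)
    then have "?\<delta> (map e ?is) = 0" using eq[of ?is] by (simp add: subseq_filter_left)
    then show ?thesis
      using alternating_form_abs_mset[OF \<delta>, of "map e ?is" "map e js"] m by simp
  qed
  then show "\<alpha> xs = \<beta> xs"
    using alternating_form_eq_0_basis[OF \<delta>] by simp
qed

section \<open>The basis forms and their values\<close>

definition coord :: "7 \<Rightarrow> (real^7) form" where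
  "coord i xs = (if length xs = 1 then hd xs $ i else 0)"

lemma dual_form_Cons: "dual_form (i # is) = coord i \<and>\<^sub>f dual_form is"
  unfolding dual_form.simps coord_def ..

lemma alternating_form_coord: "alternating_form 1 (coord i)"
  unfolding One_nat_def alternating_form_Suc alternating_form_0
  by (auto simp: coord_def interior_def linear_iff)

lemma alternating_form_dual_form: "alternating_form (length is) (dual_form is)"
proof (induction "is")
  case Nil
  then show ?case by (simp add: alternating_form_0)
next
  case (Cons i "is")
  then show ?case
    using alternating_form_wedge[OF alternating_form_coord Cons] by (simp add: dual_form_Cons del: dual_form.simps(2))
qed

lemma wedge_0_form:
  assumes "alternating_form 0 \<alpha>"
  shows "(\<alpha> \<and>\<^sub>f \<beta>) xs = \<alpha> [] * \<beta> xs"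
proof (induction xs arbitrary: \<beta>)
  case Nil
  then show ?case by (simp add: wedge_Nil)
next
  case (Cons x xs)
  then show ?case
    by (simp add: wedge_Cons[OF assms] alternating_form_0_interior[OF assms])
      (simp add: interior_def)
qed

lemma coord_wedge_Nil: "(coord i \<and>\<^sub>f \<beta>) [] = 0"
  by (simp add: wedge_Nil coord_def)

text \<open>The antiderivation rule, with the scalar \<open>x $ i\<close> as interior product of the
  coordinate form. Iterated, it is the cofactor expansion that evaluates every
  \<open>dual_form\<close>.\<close>

lemma coord_wedge_Cons:
  "(coord i \<and>\<^sub>f \<beta>) (x # xs) = x $ i * \<beta> xs - (coord i \<and>\<^sub>f interior x \<beta>) xs"
proof -
  have "alternating_form 0 (interior x (coord i))"
    using alternating_form_interior[OF alternating_form_coord] by simp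
  then show ?thesis
    using wedge_0_form[of "interior x (coord i)" \<beta> xs]
    by (simp add: wedge_Cons[OF alternating_form_coord]) (simp add: interior_def coord_def)
qed

lemma interior_coord_wedge:
  "interior x (coord i \<and>\<^sub>f \<beta>) = (\<lambda>xs. x $ i * \<beta> xs - (coord i \<and>\<^sub>f interior x \<beta>) xs)"
  by (simp add: interior_def[of x "coord i \<and>\<^sub>f \<beta>"] coord_wedge_Cons fun_eq_iff)

lemma e_nth: "e i $ j = (if i = j then 1 else 0)"
  by (auto simp: e_def axis_def)

lemma interior_dual_form_notin:
  "j \<notin> set is \<Longrightarrow> interior (e j) (dual_form is) = (\<lambda>_. 0)"
proof (induction "is")
  case Nil
  then show ?case by (simp add: interior_def fun_eq_iff)
next
  case (Cons i "is")
  then show ?case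
    by (simp add: dual_form_Cons interior_coord_wedge e_nth del: dual_form.simps)
qed

text \<open>By distinctness \<open>interior (e i)\<close> annihilates the remaining factors, so only
  the leading term of each expansion survives.\<close>

lemma dual_form_basis: "distinct is \<Longrightarrow> dual_form is (map e is) = 1"
proof (induction "is")
  case (Cons i "is")
  then show ?case
    by (simp add: dual_form_Cons coord_wedge_Cons e_nth interior_dual_form_notin del: dual_form.simps(2))
qed simp

section \<open>Nondegeneracy of the wedge pairing\<close>

lemma interior_commute_zero:
  assumes "alternating_form k \<alpha>" "interior y \<alpha> = (\<lambda>_. 0)"
  shows "interior y (interior x \<alpha>) = (\<lambda>_. 0)"
proof
  fix xs
  have "interior y \<alpha> (x # xs) = 0" using assms(2) by simp
  then show "interior y (interior x \<alpha>) xs = 0"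
    using alternating_form_swap[OF assms(1), of x y xs] by (simp add: interior_def)
qed

text \<open>With too few entries in \<open>xs\<close>, every shuffle has to give \<alpha> an entry
  of \<open>ys\<close>.\<close>

lemma wedge_append_eq_0:
  assumes "alternating_form p \<alpha>" "\<And>y. y \<in> set ys \<Longrightarrow> interior y \<alpha> = (\<lambda>_. 0)" "length xs < p"
  shows "(\<alpha> \<and>\<^sub>f \<beta>) (xs @ ys) = 0"
  using assms
proof (induction xs arbitrary: p \<alpha> \<beta>)
  case Nil
  then show ?case
  proof (induction ys arbitrary: \<beta>)
    case Nil
    then show ?case using alternating_formD(1)[OF Nil.prems(1), of "[]"] by (simp add: wedge_Nil)
  next
    case (Cons y ys)
    then have "(\<alpha> \<and>\<^sub>f interior y \<beta>) ys = 0" by simp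
    then show ?case
      using Cons.prems by (simp add: wedge_Cons[OF Cons.prems(1)])
  qed
next
  case (Cons x xs)
  have "(interior x \<alpha> \<and>\<^sub>f \<beta>) (xs @ ys) = 0"
    using Cons.prems interior_commute_zero[OF Cons.prems(1)]
    by (intro Cons.IH[OF alternating_form_interior[OF Cons.prems(1)]]) auto
  moreover have "(\<alpha> \<and>\<^sub>f interior x \<beta>) (xs @ ys) = 0"
    using Cons.prems by (intro Cons.IH[OF Cons.prems(1)]) auto
  ultimately show ?case
    by (simp add: wedge_Cons[OF Cons.prems(1)])
qed

text \<open>The only surviving shuffle gives all of \<open>xs\<close> to \<alpha>; the others are
  removed by \<open>wedge_append_eq_0\<close>.\<close>

lemma wedge_append:
  assumes "alternating_form p \<alpha>" "\<And>y. y \<in> set ys \<Longrightarrow> interior y \<alpha> = (\<lambda>_. 0)" "length xs = p"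
  shows "(\<alpha> \<and>\<^sub>f \<beta>) (xs @ ys) = \<alpha> xs * \<beta> ys"
  using assms
proof (induction xs arbitrary: p \<alpha>)
  case Nil
  then show ?case by (simp add: wedge_0_form)
next
  case (Cons x xs)
  have "(interior x \<alpha> \<and>\<^sub>f \<beta>) (xs @ ys) = interior x \<alpha> xs * \<beta> ys"
    using Cons.prems interior_commute_zero[OF Cons.prems(1)]
    by (intro Cons.IH[OF alternating_form_interior[OF Cons.prems(1)]]) auto
  moreover have "(\<alpha> \<and>\<^sub>f interior x \<beta>) (xs @ ys) = 0"
    using Cons.prems by (intro wedge_append_eq_0[OF Cons.prems(1)]) auto
  ultimately show ?case
    by (simp add: wedge_Cons[OF Cons.prems(1)]) (simp add: interior_def)
qed

text \<open>Each coefficient of \<delta> is isolated by wedging with the \<open>dual_form\<close> of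
  the complementary indices.\<close>

lemma wedge_nondegenerate:
  fixes \<delta> :: "(real^7) form"
  assumes \<delta>: "alternating_form q \<delta>" and pq: "p + q = 7"
    and z: "\<And>\<alpha>. alternating_form p \<alpha> \<Longrightarrow> \<alpha> \<and>\<^sub>f \<delta> = (\<lambda>_. 0)"
  shows "\<delta> = (\<lambda>_. 0)"
proof -
  have "\<delta> (map e is) = 0" if len: "length is = q" for "is"
  proof (cases "distinct is")
    case False
    then show ?thesis
      using alternating_formD(3)[OF \<delta>, of "map e is"] by (simp add: distinct_map)
  next
    case True
    obtain js where js: "set js = - set is" "distinct js"
      using finite_distinct_list[of "- set is"] by auto
    have "length js = 7 - q"
      using js len True distinct_card[of js] distinct_card[of "is"] by (simp add: Compl_eq_Diff_UNIV card_Diff_subset)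
    then have len_js: "length js = p" using pq by simp
    have "(dual_form js \<and>\<^sub>f \<delta>) (map e js @ map e is) = dual_form js (map e js) * \<delta> (map e is)"
      using js len_js
      by (intro wedge_append[OF alternating_form_dual_form]) (auto intro: interior_dual_form_notin)
    moreover have "dual_form js \<and>\<^sub>f \<delta> = (\<lambda>_. 0)"
      using z alternating_form_dual_form[of js] len_js by simp
    ultimately show ?thesis
      using dual_form_basis[OF js(2)] by simp
  qed
  then show ?thesis
    using alternating_form_eq_0_basis[OF \<delta>] by blast
qed

subsection \<open>Orthonormal bases and the volume form\<close>

lemma inj_e: "inj e"
  by (rule injI) (metis e_nth zero_neq_one)

lemma sum_range_e: "(\<Sum>x\<in>range e. F x) = (\<Sum>i\<in>UNIV. F (e i))"
  using sum.reindex[OF inj_e, of F] by simp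

lemma orthonormal_basis_range_e: "orthonormal_basis (\<bullet>) (range e)"
proof -
  have "x \<in> span (range e)" for x
    by (subst e_expansion[of x, symmetric]) (intro span_sum span_mul span_base, simp)
  moreover have "e i = e j \<longleftrightarrow> i = j" for i j
    using inj_e by (simp add: inj_eq)
  ultimately show ?thesis
    by (auto simp: orthonormal_basis_def e_def inner_axis_axis)
qed

lemma orthonormal_basis_inner_card:
  fixes B :: "(real^7) set"
  assumes "orthonormal_basis (\<bullet>) B"
  shows "finite B" "card B = 7"
proof -
  have one: "x \<bullet> y = (if x = y then 1 else 0)" if "x \<in> B" "y \<in> B" for x y
    using assms that by (simp add: orthonormal_basis_def)
  have "pairwise orthogonal B" by (simp add: one pairwise_def orthogonal_def)
  moreover have "0 \<notin> B" using one[of 0 0] by auto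
  ultimately have ind: "independent B" by (rule pairwise_orthogonal_independent)
  then show "finite B" by (rule independent_imp_finite)
  have "card B = dim (span B)" using ind by (simp add: dim_eq_card_independent)
  then show "card B = 7" using assms by (simp add: orthonormal_basis_def del: dim_span)
qed

lemma orthonormal_basis_inner_expansion:
  fixes B :: "(real^7) set"
  assumes "orthonormal_basis (\<bullet>) B"
  shows "(\<Sum>b\<in>B. (x \<bullet> b) *\<^sub>R b) = x"
proof (rule orthonormal_basis_expand)
  show "pairwise orthogonal B" "\<And>b. b \<in> B \<Longrightarrow> norm b = 1" "x \<in> span B"
    using assms by (auto simp: orthonormal_basis_def pairwise_def orthogonal_def norm_eq_1)
  show "finite B" using orthonormal_basis_inner_card[OF assms] by simp
qed

text \<open>Invariance of a trace: expand each \<open>e i\<close> in \<open>B\<close>, exchange the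
  sums and recombine.\<close>

lemma sum_orthonormal_basis:
  fixes f h :: "real^7 \<Rightarrow> real"
  assumes B: "orthonormal_basis (\<bullet>) B" and f: "linear f" and h: "linear h"
  shows "(\<Sum>b\<in>B. f b * h b) = (\<Sum>i\<in>UNIV. f (e i) * h (e i))"
proof -
  have f_B: "(\<Sum>b\<in>B. (x \<bullet> b) * f b) = f x" for x
  proof -
    have "f x = f (\<Sum>b\<in>B. (x \<bullet> b) *\<^sub>R b)" by (simp add: orthonormal_basis_inner_expansion[OF B])
    then show ?thesis by (simp add: linear_sum[OF f] linear_cmul[OF f])
  qed
  have "(\<Sum>i\<in>UNIV. f (e i) * h (e i)) = (\<Sum>i\<in>UNIV. \<Sum>b\<in>B. (e i \<bullet> b) * f b * h (e i))"
    by (simp add: sum_distrib_right[symmetric] f_B)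
  also have "\<dots> = (\<Sum>b\<in>B. f b * (\<Sum>i\<in>UNIV. b $ i * h (e i)))"
    by (subst sum.swap) (simp add: sum_distrib_left e_def inner_axis' mult_ac)
  also have "\<dots> = (\<Sum>b\<in>B. f b * h b)"
    by (simp add: linear_e_expansion[OF h, symmetric])
  finally show ?thesis by simp
qed

section \<open>Inner products of forms in an arbitrary orthonormal basis\<close>

lemma sum_lists_Suc:
  "(\<Sum>xs | set xs \<subseteq> B \<and> length xs = Suc k. F xs) =
   (\<Sum>x\<in>B. \<Sum>xs | set xs \<subseteq> B \<and> length xs = k. F (x # xs))"
proof -
  have "{xs. set xs \<subseteq> B \<and> length xs = Suc k} =
      (\<lambda>(x, xs). x # xs) ` (B \<times> {xs. set xs \<subseteq> B \<and> length xs = k})"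
    by (auto simp: length_Suc_conv image_iff)
  moreover have "inj_on (\<lambda>(x, xs). x # xs) (B \<times> {xs. set xs \<subseteq> B \<and> length xs = k})"
    by (auto simp: inj_on_def)
  ultimately show ?thesis
    by (simp add: sum.reindex sum.cartesian_product split_def)
qed

lemma lists_length_0: "{xs. set xs \<subseteq> B \<and> length xs = 0} = {[]}"
  by auto

text \<open>Makes the unspecified basis in \<open>form_inner\<close> harmless. The basis is
  exchanged one slot at a time: the tail by induction, the head by
  \<open>sum_orthonormal_basis\<close>.\<close>

lemma sum_lists_orthonormal_basis:
  fixes \<alpha> \<beta> :: "(real^7) form"
  assumes B: "orthonormal_basis (\<bullet>) B"
  shows "alternating_form k \<alpha> \<Longrightarrow> alternating_form k \<beta> \<Longrightarrow>
    (\<Sum>xs | set xs \<subseteq> B \<and> length xs = k. \<alpha> xs * \<beta> xs) =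
    (\<Sum>xs | set xs \<subseteq> range e \<and> length xs = k. \<alpha> xs * \<beta> xs)"
proof (induction k arbitrary: \<alpha> \<beta>)
  case 0
  then show ?case by (simp only: lists_length_0)
next
  case (Suc k)
  let ?E = "{xs. set xs \<subseteq> range e \<and> length xs = k}"
  have "(\<Sum>xs | set xs \<subseteq> B \<and> length xs = Suc k. \<alpha> xs * \<beta> xs) =
      (\<Sum>x\<in>B. \<Sum>xs\<in>?E. \<alpha> (x # xs) * \<beta> (x # xs))"
    unfolding sum_lists_Suc
  proof (rule sum.cong[OF refl])
    fix x
    show "(\<Sum>xs | set xs \<subseteq> B \<and> length xs = k. \<alpha> (x # xs) * \<beta> (x # xs)) =
        (\<Sum>xs\<in>?E. \<alpha> (x # xs) * \<beta> (x # xs))"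
      using Suc.IH[of "interior x \<alpha>" "interior x \<beta>"] Suc.prems
      by (simp add: alternating_form_Suc) (simp add: interior_def)
  qed
  also have "\<dots> = (\<Sum>xs\<in>?E. \<Sum>x\<in>B. \<alpha> (x # xs) * \<beta> (x # xs))"
    by (rule sum.swap)
  also have "\<dots> = (\<Sum>xs\<in>?E. \<Sum>i\<in>UNIV. \<alpha> (e i # xs) * \<beta> (e i # xs))"
    using Suc.prems by (simp add: sum_orthonormal_basis[OF B] alternating_form_Suc)
  also have "\<dots> = (\<Sum>x\<in>range e. \<Sum>xs\<in>?E. \<alpha> (x # xs) * \<beta> (x # xs))"
    unfolding sum_range_e by (rule sum.swap)
  finally show ?case by (simp only: sum_lists_Suc)
qed

lemma form_inner_eq:
  fixes \<alpha> \<beta> :: "(real^7) form"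
  assumes "alternating_form k \<alpha>" "alternating_form k \<beta>"
  shows "form_inner (\<bullet>) k \<alpha> \<beta> = (\<Sum>xs | set xs \<subseteq> range e \<and> length xs = k. \<alpha> xs * \<beta> xs) / fact k"
  using sum_lists_orthonormal_basis[OF someI[of "orthonormal_basis (\<bullet>)", OF orthonormal_basis_range_e] assms]
  by (simp add: form_inner_def Let_def)

text \<open>Only the \<open>fact n\<close> orderings of \<open>B\<close> contribute, and reordering
  preserves the square.\<close>

lemma sum_lists_top_form:
  assumes \<alpha>: "alternating_form n \<alpha>" and B: "finite B" "card B = n"
    and xs0: "distinct xs0" "set xs0 = B"
  shows "(\<Sum>xs | set xs \<subseteq> B \<and> length xs = n. \<alpha> xs * \<alpha> xs) = fact n * (\<alpha> xs0)\<^sup>2"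
proof -
  let ?D = "{xs. length xs = n \<and> distinct xs \<and> set xs \<subseteq> B}"
  have "(\<Sum>xs | set xs \<subseteq> B \<and> length xs = n. \<alpha> xs * \<alpha> xs) = (\<Sum>xs\<in>?D. \<alpha> xs * \<alpha> xs)"
    using alternating_formD(3)[OF \<alpha>] finite_lists_length_eq[OF B(1)]
    by (intro sum.mono_neutral_right) auto
  also have "\<dots> = (\<Sum>xs\<in>?D. (\<alpha> xs0)\<^sup>2)"
  proof (rule sum.cong[OF refl])
    fix xs assume xs: "xs \<in> ?D"
    then have "set xs = B" using B card_subset_eq[of B "set xs"] distinct_card[of xs] by simp
    then have "mset xs = mset xs0"
      using xs xs0 by (simp add: set_eq_iff_mset_eq_distinct[symmetric])
    then show "\<alpha> xs * \<alpha> xs = (\<alpha> xs0)\<^sup>2"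
      using alternating_form_abs_mset[OF \<alpha>] by (metis power2_abs power2_eq_square)
  qed
  also have "\<dots> = fact n * (\<alpha> xs0)\<^sup>2"
    using card_lists_distinct_length_eq[OF B(1), of n] B(2) by (simp add: fact_prod)
  finally show ?thesis .
qed

section \<open>Forms of top degree\<close>

abbreviation idx :: "7 list" where
  "idx \<equiv> [1, 2, 3, 4, 5, 6, 7]"

lemma distinct_idx: "distinct idx"
  by simp

lemma set_idx: "set idx = UNIV"
proof -
  have "card (set idx) = 7" using distinct_card[OF distinct_idx] by simp
  then show ?thesis by (intro card_subset_eq) simp_all
qed

abbreviation e_vol :: "(real^7) form" where
  "e_vol \<equiv> dual_form idx"

lemma alternating_form_e_vol: "alternating_form 7 e_vol"
  using alternating_form_dual_form[of idx] by (simp del: dual_form.simps add: eval_nat_numeral)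

text \<open>Top forms make up a line: \<open>idx\<close> is the only increasing index list of length
  7, and \<open>e_vol\<close> has value 1 there.\<close>

lemma top_form_eq:
  fixes \<alpha> :: "(real^7) form"
  assumes "alternating_form 7 \<alpha>"
  shows "\<alpha> = (\<lambda>xs. \<alpha> (map e idx) * e_vol xs)"
proof (rule alternating_form_eqI_basis[OF assms _ distinct_idx set_idx])
  show "alternating_form 7 (\<lambda>xs. \<alpha> (map e idx) * e_vol xs)"
    by (rule alternating_form_scale[OF alternating_form_e_vol])
  fix "is" assume "is \<in> set (subseqs idx)" "length is = 7"
  then have "is = idx"
    using subseq_same_length[of "is" idx] by (simp del: subseqs.simps)
  then show "\<alpha> (map e is) = \<alpha> (map e idx) * e_vol (map e is)"
    using dual_form_basis[OF distinct_idx] by (simp del: dual_form.simps)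
qed

text \<open>In place of a determinant, the sum of squares over all orderings is used: it is the same
  for every orthonormal basis, hence so is the absolute value.\<close>

lemma volume_form_e_vol: "volume_form (\<bullet>) e_vol"
  unfolding volume_form_def
proof (intro conjI allI impI)
  show "alternating_form DIM(real^7) e_vol"
    using alternating_form_e_vol by simp
  fix xs :: "(real^7) list" assume xs: "distinct xs \<and> orthonormal_basis (\<bullet>) (set xs)"
  have "fact 7 * (e_vol xs)\<^sup>2 = fact 7 * (e_vol (map e idx))\<^sup>2"
    using sum_lists_top_form[OF alternating_form_e_vol orthonormal_basis_inner_card, of "set xs" xs]
      sum_lists_top_form[OF alternating_form_e_vol orthonormal_basis_inner_card[OF orthonormal_basis_range_e], of "map e idx"]
      sum_lists_orthonormal_basis[OF _ alternating_form_e_vol alternating_form_e_vol, of "set xs"]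
      xs set_idx distinct_idx inj_e
    by (simp add: distinct_map inj_on_subset del: dual_form.simps list.map list.set)
  then show "\<bar>e_vol xs\<bar> = 1"
    using dual_form_basis[OF distinct_idx] by (simp add: abs_square_eq_1 del: dual_form.simps list.map)
qed

subsection \<open>The metric, volume form and Hodge dual of the 3-form\<close>

lemmas coord_simps = coord_wedge_Cons coord_wedge_Nil interior_def coord_def

text \<open>A 3 by 3 determinant. Every product takes its factors in the order \<open>x\<close>,
  \<open>y\<close>, \<open>z\<close> and nests to the right, the shape that \<open>delta\<close> in
  \<open>form_inner_dual_form_3\<close> contracts.\<close>

lemma dual_form_3:
  "dual_form [i, j, k] [x, y, z] =
     x $ i * (y $ j * z $ k) - x $ i * (y $ k * z $ j) - x $ j * (y $ i * z $ k)
     + x $ k * (y $ i * z $ j) + x $ j * (y $ k * z $ i) - x $ k * (y $ j * z $ i)"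
  by (simp add: dual_form_Cons coord_simps algebra_simps del: dual_form.simps(2))

text \<open>The candidate for the Hodge dual: each term of \<open>g2_phi\<close> is replaced by its
  complementary indices. All seven shuffles involved are even, so the signs carry over.\<close>

definition g2_psi :: "(real^7) form" where
  "g2_psi xs = dual_form [4,5,6,7] xs + dual_form [2,3,6,7] xs + dual_form [2,3,4,5] xs
     + dual_form [1,3,5,7] xs - dual_form [1,3,4,6] xs - dual_form [1,2,5,6] xs - dual_form [1,2,4,7] xs"

lemma alternating_form_dual_form_3: "alternating_form 3 (dual_form [i, j, k])"
  using alternating_form_dual_form[of "[i, j, k]"]
  by (simp add: eval_nat_numeral del: dual_form.simps)

lemma alternating_form_g2_phi: "alternating_form 3 g2_phi"
  unfolding g2_phi_def[abs_def]
  by (intro alternating_form_add alternating_form_diff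
      alternating_form_dual_form_3)

lemma alternating_form_g2_psi: "alternating_form 4 g2_psi"
proof -
  have "alternating_form 4 (dual_form [i, j, k, l])" for i j k l
    using alternating_form_dual_form[of "[i, j, k, l]"]
    by (simp add: eval_nat_numeral del: dual_form.simps)
  then show ?thesis
    unfolding g2_psi_def[abs_def] by (intro alternating_form_add alternating_form_diff)
qed

lemma ce_diff_4: "ce_diff br \<alpha> [x, y, z, w] =
  - \<alpha> [br x y, z, w] + \<alpha> [br x z, y, w] - \<alpha> [br y z, x, w]
  - \<alpha> [br x w, y, z] + \<alpha> [br y w, x, z] - \<alpha> [br z w, x, y]"
  by (simp add: ce_diff_def lessThan_Suc nths_Cons)

lemma ce_diff_5: "ce_diff br \<alpha> [x, y, z, w, v] =
  - \<alpha> [br x y, z, w, v] + \<alpha> [br x z, y, w, v] - \<alpha> [br y z, x, w, v]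
  - \<alpha> [br x w, y, z, v] + \<alpha> [br y w, x, z, v] - \<alpha> [br z w, x, y, v]
  + \<alpha> [br x v, y, z, w] - \<alpha> [br y v, x, z, w] + \<alpha> [br z v, x, y, w] - \<alpha> [br w v, x, y, z]"
  by (simp add: ce_diff_def lessThan_Suc nths_Cons)

text \<open>The six terms of the determinant contribute equally by antisymmetry of \<alpha>, and
  \<open>fact 3\<close> removes the multiplicity.\<close>

lemma form_inner_dual_form_3:
  assumes \<alpha>: "alternating_form 3 \<alpha>"
  shows "form_inner (\<bullet>) 3 \<alpha> (dual_form [i, j, k]) = \<alpha> [e i, e j, e k]"
proof -
  have delta: "(\<Sum>l\<in>UNIV. \<Sum>m\<in>UNIV. \<Sum>n\<in>UNIV. F l m n * (e l $ i * (e m $ j * e n $ k))) = F i j k"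
    for F :: "7 \<Rightarrow> 7 \<Rightarrow> 7 \<Rightarrow> real" and i j k
  proof -
    have *: "(\<Sum>l\<in>UNIV. f l * e l $ i) = f i" for f :: "7 \<Rightarrow> real" and i
      by (simp add: e_nth if_distrib cong: if_cong)
    show ?thesis
      by (simp add: * sum_distrib_right[symmetric] mult.assoc[symmetric])
  qed
  have s1: "\<alpha> [x, y, z] = - \<alpha> [y, x, z]" for x y z
    by (rule alternating_form_swap[OF \<alpha>])
  have s2: "\<alpha> [x, y, z] = - \<alpha> [x, z, y]" for x y z
    using alternating_form_swap[OF alternating_form_interior[OF \<alpha>], of x y z "[]"]
    by (simp add: interior_def)
  have "(\<Sum>xs | set xs \<subseteq> range e \<and> length xs = 3. \<alpha> xs * dual_form [i, j, k] xs) =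
     (\<Sum>l\<in>UNIV. \<Sum>m\<in>UNIV. \<Sum>n\<in>UNIV. \<alpha> [e l, e m, e n] * dual_form [i, j, k] [e l, e m, e n])"
    by (simp add: numeral_3_eq_3 sum_lists_Suc sum_range_e lists_length_0[simplified] del: dual_form.simps)
  also have "\<dots> = \<alpha> [e i, e j, e k] - \<alpha> [e i, e k, e j] - \<alpha> [e j, e i, e k]
      + \<alpha> [e k, e i, e j] + \<alpha> [e j, e k, e i] - \<alpha> [e k, e j, e i]"
    unfolding dual_form_3 by (simp add: distrib_left right_diff_distrib sum.distrib sum_subtractf delta)
  also have "\<dots> = 6 * \<alpha> [e i, e j, e k]"
    using s2[of "e i" "e k" "e j"] s1[of "e j" "e i" "e k"] s1[of "e k" "e i" "e j"]
      s2[of "e j" "e k" "e i"] s1[of "e k" "e j" "e i"] by simp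
  finally show ?thesis
    using form_inner_eq[OF \<alpha>, of "dual_form [i, j, k]"] alternating_form_dual_form[of "[i, j, k]"]
    by (simp add: fact_numeral numeral_3_eq_3[symmetric] del: dual_form.simps)
qed

lemma e_idx: "map e idx = [e 1, e 2, e 3, e 4, e 5, e 6, e 7]"
  by simp

lemma UNIV_7: "(UNIV :: 7 set) = {1, 2, 3, 4, 5, 6, 7}"
  using set_idx by simp

text \<open>The right-hand side is that of \<open>form_inner_g2_phi\<close>; this agreement is the
  defining property of the Hodge star.\<close>

lemma wedge_g2_psi_basis:
  assumes a3: "alternating_form 3 \<alpha>"
  shows "(\<alpha> \<and>\<^sub>f g2_psi) (map e idx) =
    \<alpha> [e 1, e 2, e 3] + \<alpha> [e 1, e 4, e 5] + \<alpha> [e 1, e 6, e 7] + \<alpha> [e 2, e 4, e 6]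
    - \<alpha> [e 2, e 5, e 7] - \<alpha> [e 3, e 4, e 7] - \<alpha> [e 3, e 5, e 6]"
proof -
  have a2: "alternating_form 2 (interior x \<alpha>)" for x
    using alternating_form_interior[OF a3] by simp
  have a1: "alternating_form 1 (interior y (interior x \<alpha>))" for x y
    using alternating_form_interior[OF a2] by simp
  have a0: "alternating_form 0 (interior z (interior y (interior x \<alpha>)))" for x y z
    using alternating_form_interior[OF a1] by simp
  note z = alternating_formD(1)[OF a3] alternating_formD(1)[OF alternating_form_g2_psi]
  show ?thesis
    unfolding e_idx wedge_Cons[OF a3] wedge_Cons[OF a2] wedge_Cons[OF a1] wedge_0_form[OF a0] wedge_Nil
      interior_def
    \<comment> \<open>Lengths first discard all terms in which \<alpha> receives fewer than three
      arguments; only the remaining 35 are evaluated.\<close>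
    by (simp add: z) (simp add: g2_psi_def dual_form_Cons coord_simps e_nth del: dual_form.simps(2))
qed

section \<open>The metric and the volume form induced by the 3-form\<close>

lemma alternating_form_interior_g2_phi:
  "alternating_form 2 (interior x g2_phi)"
  "alternating_form 1 (interior y (interior x g2_phi))"
  "alternating_form 0 (interior z (interior y (interior x g2_phi)))"
  using alternating_form_interior[OF alternating_form_interior[OF alternating_form_g2_phi], of y x]
    alternating_form_interior[OF alternating_form_g2_phi]
    alternating_form_interior[OF alternating_form_interior[OF alternating_form_interior[OF alternating_form_g2_phi]], of z y x]
  by simp_all

lemmas wedge_interior_g2_phi_Cons =
  wedge_Cons[OF alternating_form_interior_g2_phi(1)] wedge_Cons[OF alternating_form_interior_g2_phi(2)]
  wedge_0_form[OF alternating_form_interior_g2_phi(3)] wedge_Nil interior_def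

text \<open>All 21 increasing pairs, with \<open>y\<close> general: the table serves both for the
  components of \<open>interior y g2_phi\<close> and, at basis vectors, for the coefficients of
  \<open>g2_phi\<close>.\<close>

lemma g2_phi_basis:
  "g2_phi [y, e 1, e 2] = y$3" "g2_phi [y, e 1, e 3] = - y$2" "g2_phi [y, e 1, e 4] = y$5"
  "g2_phi [y, e 1, e 5] = - y$4" "g2_phi [y, e 1, e 6] = y$7" "g2_phi [y, e 1, e 7] = - y$6"
  "g2_phi [y, e 2, e 3] = y$1" "g2_phi [y, e 2, e 4] = y$6" "g2_phi [y, e 2, e 5] = - y$7"
  "g2_phi [y, e 2, e 6] = - y$4" "g2_phi [y, e 2, e 7] = y$5" "g2_phi [y, e 3, e 4] = - y$7"
  "g2_phi [y, e 3, e 5] = - y$6" "g2_phi [y, e 3, e 6] = y$5" "g2_phi [y, e 3, e 7] = y$4"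
  "g2_phi [y, e 4, e 5] = y$1" "g2_phi [y, e 4, e 6] = y$2" "g2_phi [y, e 4, e 7] = - y$3"
  "g2_phi [y, e 5, e 6] = - y$3" "g2_phi [y, e 5, e 7] = - y$2" "g2_phi [y, e 6, e 7] = y$1"
  by (simp_all add: g2_phi_def dual_form_3 e_nth del: dual_form.simps)

text \<open>First stage of the triple product. Keeping \<beta> opaque leaves only 21 values of it to
  be computed, one for each pair of arguments given to the left factor.\<close>

lemma wedge_interior_g2_phi_basis:
  "(interior x g2_phi \<and>\<^sub>f \<beta>) (map e idx) =
    x$1 * (\<beta> [e 1, e 4, e 5, e 6, e 7] + \<beta> [e 1, e 2, e 3, e 6, e 7] + \<beta> [e 1, e 2, e 3, e 4, e 5]) +
    x$2 * (\<beta> [e 2, e 4, e 5, e 6, e 7] - \<beta> [e 1, e 2, e 3, e 5, e 7] + \<beta> [e 1, e 2, e 3, e 4, e 6]) +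
    x$3 * (\<beta> [e 3, e 4, e 5, e 6, e 7] - \<beta> [e 1, e 2, e 3, e 5, e 6] - \<beta> [e 1, e 2, e 3, e 4, e 7]) +
    x$4 * (\<beta> [e 2, e 3, e 4, e 6, e 7] + \<beta> [e 1, e 3, e 4, e 5, e 7] - \<beta> [e 1, e 2, e 4, e 5, e 6]) +
    x$5 * (\<beta> [e 2, e 3, e 5, e 6, e 7] + \<beta> [e 1, e 3, e 4, e 5, e 6] + \<beta> [e 1, e 2, e 4, e 5, e 7]) +
    x$6 * (\<beta> [e 2, e 3, e 4, e 5, e 6] - \<beta> [e 1, e 3, e 5, e 6, e 7] + \<beta> [e 1, e 2, e 4, e 6, e 7]) +
    x$7 * (\<beta> [e 2, e 3, e 4, e 5, e 7] - \<beta> [e 1, e 3, e 4, e 6, e 7] - \<beta> [e 1, e 2, e 5, e 6, e 7])"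
  unfolding e_idx wedge_interior_g2_phi_Cons
  by (simp add: alternating_formD(1)[OF alternating_form_g2_phi])
    (simp add: g2_phi_basis e_nth algebra_simps)

text \<open>Second stage: one term for each of the ten ways to give two of the five arguments to the
  left factor.\<close>

lemma wedge_interior_g2_phi_g2_phi:
  "(interior y g2_phi \<and>\<^sub>f g2_phi) [u, v, w, p, q] =
    g2_phi [y, u, v] * g2_phi [w, p, q] - g2_phi [y, u, w] * g2_phi [v, p, q]
    + g2_phi [y, u, p] * g2_phi [v, w, q] - g2_phi [y, u, q] * g2_phi [v, w, p]
    + g2_phi [y, v, w] * g2_phi [u, p, q] - g2_phi [y, v, p] * g2_phi [u, w, q]
    + g2_phi [y, v, q] * g2_phi [u, w, p] + g2_phi [y, w, p] * g2_phi [u, v, q]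
    - g2_phi [y, w, q] * g2_phi [u, v, p] + g2_phi [y, p, q] * g2_phi [u, v, w]"
  unfolding wedge_interior_g2_phi_Cons
  by (simp add: alternating_formD(1)[OF alternating_form_g2_phi])

lemma inner_7: "x \<bullet> y = x$1 * y$1 + x$2 * y$2 + x$3 * y$3 + x$4 * y$4 + x$5 * y$5 + x$6 * y$6 + x$7 * y$7"
  for x y :: "real^7"
  unfolding inner_vec_def UNIV_7 by simp

lemma wedge_wedge_g2_phi_basis:
  "(interior x g2_phi \<and>\<^sub>f interior y g2_phi \<and>\<^sub>f g2_phi) (map e idx) = 6 * (x \<bullet> y)"
  unfolding wedge_interior_g2_phi_basis inner_7 wedge_interior_g2_phi_g2_phi g2_phi_basis
  by (simp add: e_nth algebra_simps)

text \<open>Both sides of the defining equation are top forms, so their values on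
  \<open>map e idx\<close> decide.\<close>

lemma g2_induces_inner: "g2_induces g2_phi (\<bullet>) e_vol"
  unfolding g2_induces_def
proof (intro conjI allI)
  show "inner_product (\<bullet>)"
    by (auto simp: inner_product_def bilinear_def linear_iff inner_add inner_commute)
  show "volume_form (\<bullet>) e_vol" by (rule volume_form_e_vol)
  fix x y :: "real^7"
  have "alternating_form 7 (interior x g2_phi \<and>\<^sub>f interior y g2_phi \<and>\<^sub>f g2_phi)"
    using alternating_form_wedge[OF alternating_form_interior_g2_phi(1)
        alternating_form_wedge[OF alternating_form_interior_g2_phi(1) alternating_form_g2_phi]] by simp
  then show "interior x g2_phi \<and>\<^sub>f interior y g2_phi \<and>\<^sub>f g2_phi = (\<lambda>xs. 6 * (x \<bullet> y) * e_vol xs)"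
    by (subst top_form_eq) (simp_all only: wedge_wedge_g2_phi_basis)
qed

text \<open>The basis value of the defining equation makes \<open>g\<close> proportional to the
  standard inner product. The factor is fixed by comparing how metric and volume scale: a rescaled
  basis is orthonormal for \<open>g\<close>, and its volume must be 1 up to sign.\<close>

lemma g2_induces_unique:
  assumes "g2_induces g2_phi g vol"
  shows "g = (\<bullet>)" "vol = e_vol"
proof -
  have g: "inner_product g" and v: "volume_form g vol"
    and eq: "interior x g2_phi \<and>\<^sub>f interior y g2_phi \<and>\<^sub>f g2_phi = (\<lambda>xs. 6 * g x y * vol xs)" for x y
    using assms by (auto simp: g2_induces_def)
  define l where "l = vol (map e idx)"
  have alt: "alternating_form 7 vol" using v by (simp add: volume_form_def)
  have lg: "x \<bullet> y = l * g x y" for x y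
    using fun_cong[OF eq[of x y], of "map e idx"] wedge_wedge_g2_phi_basis[of x y]
    by (simp add: l_def del: list.map)
  have "e 1 \<bullet> e 1 = 1" by (simp add: e_def inner_axis_axis)
  \<comment> \<open>Positivity of both inner products determines the orientation.\<close>
  then have "0 < l * g (e 1) (e 1)" using lg[of "e 1" "e 1"] by simp
  moreover have "0 < g (e 1) (e 1)"
    using g \<open>e 1 \<bullet> e 1 = 1\<close> unfolding inner_product_def by (metis inner_zero_left zero_neq_one)
  ultimately have l: "0 < l" by (simp add: zero_less_mult_iff)
  \<comment> \<open>Chosen so that the vectors \<open>s *\<^sub>R e i\<close> are orthonormal for
    \<open>g\<close>.\<close>
  define s where "s = sqrt l"
  have s: "0 < s" "s\<^sup>2 = l" using l by (simp_all add: s_def)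
  let ?xs = "map (scaleR s) (map e idx)"
  have "l * g (s *\<^sub>R x) (s *\<^sub>R y) = l * (x \<bullet> y)" for x y
    using lg[of "s *\<^sub>R x" "s *\<^sub>R y"] s(2) by (simp add: power2_eq_square mult.assoc[symmetric]) auto
  then have "g (s *\<^sub>R x) (s *\<^sub>R y) = x \<bullet> y" for x y
    using l by simp
  moreover have "span (scaleR s ` range e) = UNIV"
  proof -
    have "x \<in> span (scaleR s ` range e)" for x
    proof -
      have "(\<Sum>i\<in>UNIV. (x $ i / s) *\<^sub>R (s *\<^sub>R e i)) \<in> span (scaleR s ` range e)"
        by (rule span_sum, rule span_mul, rule span_base) blast
      then show ?thesis using s(1) by (simp add: e_expansion)
    qed
    then show ?thesis by auto
  qed
  ultimately have "orthonormal_basis g (scaleR s ` range e)"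
    using orthonormal_basis_range_e s(1) by (auto simp: orthonormal_basis_def)
  moreover have "set ?xs = scaleR s ` range e"
    unfolding set_map set_idx ..
  moreover have "inj (scaleR s \<circ> e)"
    using s(1) inj_e by (auto simp: inj_def)
  then have "distinct ?xs"
    unfolding map_map distinct_map using distinct_idx inj_on_subset by blast
  ultimately have "\<bar>vol ?xs\<bar> = 1"
    using v unfolding volume_form_def by metis
  \<comment> \<open>Seven factors come from the arguments; the other two from \<open>l\<close>, the
    volume of the unscaled basis.\<close>
  moreover have "vol ?xs = s ^ 7 * s\<^sup>2"
    using alternating_form_map_scaleR[OF alt, of "map e idx" s] s by (simp add: l_def del: list.map)
  moreover have "0 \<le> s ^ 7 * s\<^sup>2" using s(1) by simp
  ultimately have "s ^ 7 * s\<^sup>2 = 1" by linarith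
  then have "s ^ 9 = 1"
    using power_add[of s 7 2] by simp
  then have "s = 1"
    using s(1) power_eq_1_iff[of s 9] by simp
  then have "l = 1" using s(2) by simp
  then show "g = (\<bullet>)" "vol = e_vol"
    using lg top_form_eq[OF alt] l_def by (auto simp: fun_eq_iff simp del: list.map dual_form.simps)
qed

lemma g2_metric_g2_phi: "g2_metric g2_phi = (\<bullet>)"
  unfolding g2_metric_def using g2_induces_inner g2_induces_unique(1) by (intro the_equality) blast+

lemma g2_volume_g2_phi: "g2_volume g2_phi = e_vol"
  unfolding g2_volume_def using g2_induces_inner g2_induces_unique(2) by (intro the_equality) blast+

lemma form_inner_g2_phi:
  assumes "alternating_form 3 \<alpha>"
  shows "form_inner (\<bullet>) 3 \<alpha> g2_phi =
    \<alpha> [e 1, e 2, e 3] + \<alpha> [e 1, e 4, e 5] + \<alpha> [e 1, e 6, e 7] + \<alpha> [e 2, e 4, e 6]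
    - \<alpha> [e 2, e 5, e 7] - \<alpha> [e 3, e 4, e 7] - \<alpha> [e 3, e 5, e 6]"
  unfolding form_inner_dual_form_3[OF assms, symmetric]
  by (simp add: form_inner_def Let_def g2_phi_def distrib_left right_diff_distrib sum.distrib
      sum_subtractf add_divide_distrib diff_divide_distrib del: dual_form.simps)

text \<open>Existence compares the coefficients of two top forms; uniqueness is the nondegeneracy of
  the pairing of 3-forms with 4-forms.\<close>

lemma hodge_star_g2_phi: "hodge_star (\<bullet>) e_vol 3 g2_phi = g2_psi"
proof -
  have psi: "\<alpha> \<and>\<^sub>f g2_psi = (\<lambda>xs. form_inner (\<bullet>) 3 \<alpha> g2_phi * e_vol xs)"
    if \<alpha>: "alternating_form 3 \<alpha>" for \<alpha>
    using top_form_eq[of "\<alpha> \<and>\<^sub>f g2_psi"] alternating_form_wedge[OF \<alpha> alternating_form_g2_psi]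
    by (simp add: wedge_g2_psi_basis[OF \<alpha>] form_inner_g2_phi[OF \<alpha>] del: dual_form.simps list.map)
  show ?thesis
    unfolding hodge_star_def
  proof (rule the_equality)
    show "alternating_form (DIM(real^7) - 3) g2_psi \<and>
      (\<forall>\<alpha>. alternating_form 3 \<alpha> \<longrightarrow> \<alpha> \<and>\<^sub>f g2_psi = (\<lambda>xs. form_inner (\<bullet>) 3 \<alpha> g2_phi * e_vol xs))"
      using psi alternating_form_g2_psi by simp
    fix \<gamma> :: "(real^7) form"
    assume "alternating_form (DIM(real^7) - 3) \<gamma> \<and>
      (\<forall>\<alpha>. alternating_form 3 \<alpha> \<longrightarrow> \<alpha> \<and>\<^sub>f \<gamma> = (\<lambda>xs. form_inner (\<bullet>) 3 \<alpha> g2_phi * e_vol xs))"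
    then have \<gamma>: "alternating_form 4 \<gamma>"
      and eq: "\<And>\<alpha>. alternating_form 3 \<alpha> \<Longrightarrow> \<alpha> \<and>\<^sub>f \<gamma> = \<alpha> \<and>\<^sub>f g2_psi"
      using psi by simp_all
    have "(\<lambda>xs. \<gamma> xs - g2_psi xs) = (\<lambda>_. 0)"
      by (rule wedge_nondegenerate[of 4 _ 3])
        (use eq in \<open>auto simp: wedge_diff_right fun_eq_iff
          intro: alternating_form_diff[OF \<gamma> alternating_form_g2_psi]\<close>)
    then show "\<gamma> = g2_psi" by (simp add: fun_eq_iff)
  qed
qed

subsection \<open>The differentials of the 3-form and its dual\<close>

lemma alternating_form_scaleR_Cons:
  assumes "alternating_form k \<alpha>"
  shows "\<alpha> (c *\<^sub>R x # xs) = c * \<alpha> (x # xs)" "\<alpha> (- c *\<^sub>R x # xs) = - c * \<alpha> (x # xs)" "\<alpha> (0 # xs) = 0"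
proof -
  note l = alternating_form_linear_Cons[OF assms, of xs]
  show "\<alpha> (c *\<^sub>R x # xs) = c * \<alpha> (x # xs)" "\<alpha> (- c *\<^sub>R x # xs) = - c * \<alpha> (x # xs)" "\<alpha> (0 # xs) = 0"
    using linear_cmul[OF l, of c x] linear_cmul[OF l, of "- c" x] linear_0[OF l] by simp_all
qed

lemma alternating_form_ce_diff_g_bracket:
  "alternating_form k \<alpha> \<Longrightarrow> alternating_form (Suc k) (ce_diff (g_bracket a b c) \<alpha>)"
  using lie_bracket_g_bracket[of a b c] by (intro alternating_form_ce_diff) (auto simp: lie_bracket_def)

lemma ce_diff_g2_phi_basis:
  assumes "a + b + c = 0"
  shows "\<forall>is\<in>set (subseqs idx). length is = 4 \<longrightarrow> ce_diff (g_bracket a b c) g2_phi (map e is) = 0"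
  using assms
  by (simp add: Let_def ce_diff_4 g_bracket_basis g2_phi_basis e_nth
      alternating_form_scaleR_Cons[OF alternating_form_g2_phi])

text \<open>A coefficient that detects the sum, for the converse direction.\<close>

lemma ce_diff_g2_phi_1247: "ce_diff (g_bracket a b c) g2_phi [e 1, e 2, e 4, e 7] = a + b + c"
  by (simp add: ce_diff_4 g_bracket_basis alternating_form_scaleR_Cons[OF alternating_form_g2_phi]
     g2_phi_basis e_nth)

text \<open>A check of 21 index lists. Structurally, one part of \<psi> is half the square of the
  invariant Kaehler form; the other contains \<open>e 1\<close> dually as a factor, and so does
  every nonzero differential, so a repeated factor kills it.\<close>

lemma ce_diff_g2_psi_basis:
  "\<forall>is\<in>set (subseqs idx). length is = 5 \<longrightarrow> ce_diff (g_bracket a b c) g2_psi (map e is) = 0"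
  \<comment> \<open>Brackets are evaluated and scalars pulled out while \<open>g2_psi\<close> is
    still folded; it is then unfolded on basis vectors only.\<close>
  by (simp add: Let_def ce_diff_5 g_bracket_basis
      alternating_form_scaleR_Cons[OF alternating_form_g2_psi])
    (simp add: g2_psi_def dual_form_Cons coord_simps e_nth del: dual_form.simps(2))

theorem proposition4p1:
  fixes a b c :: real
  assumes "a\<^sup>2 + b\<^sup>2 + c\<^sup>2 \<noteq> 0"
  shows "g2_coclosed (g_bracket a b c) g2_phi \<and>
    (g2_closed (g_bracket a b c) g2_phi \<longleftrightarrow> a + b + c = 0) \<and>
    (g2_torsion_free (g_bracket a b c) g2_phi \<longleftrightarrow> a + b + c = 0)"
proof -
  have "ce_diff (g_bracket a b c) g2_psi = (\<lambda>_. 0)"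
  proof (rule alternating_form_eqI_basis[OF _ _ distinct_idx set_idx])
    show "alternating_form 5 (ce_diff (g_bracket a b c) g2_psi)"
      using alternating_form_ce_diff_g_bracket[OF alternating_form_g2_psi] by simp
    show "alternating_form 5 (\<lambda>_::(real^7) list. 0)" by simp
  qed (use ce_diff_g2_psi_basis in blast)
  then have "g2_coclosed (g_bracket a b c) g2_phi"
    by (simp add: g2_coclosed_def g2_metric_g2_phi g2_volume_g2_phi hodge_star_g2_phi
        del: dual_form.simps)
  moreover have "g2_closed (g_bracket a b c) g2_phi \<longleftrightarrow> a + b + c = 0"
  proof
    assume "g2_closed (g_bracket a b c) g2_phi"
    then show "a + b + c = 0"
      using ce_diff_g2_phi_1247[of a b c] by (simp add: g2_closed_def)
  next
    assume abc: "a + b + c = 0"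
    show "g2_closed (g_bracket a b c) g2_phi"
      unfolding g2_closed_def
    proof (rule alternating_form_eqI_basis[OF _ _ distinct_idx set_idx])
      show "alternating_form 4 (ce_diff (g_bracket a b c) g2_phi)"
        using alternating_form_ce_diff_g_bracket[OF alternating_form_g2_phi] by simp
      show "alternating_form 4 (\<lambda>_::(real^7) list. 0)" by simp
    qed (use ce_diff_g2_phi_basis[OF abc] in blast)
  qed
  ultimately show ?thesis by (simp add: g2_torsion_free_def)
qed

end
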